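(* Let $\pi:X\to[a,b]$ be a tame function such that $\pi|_B$ has a unique critical point, and this critical point is of type D. Then $\pi$ is $0$-sectional, i.e. every path $\gamma:([a,b],a,b)\to(X,\pi^{-1}(a),\pi^{-1}(b))$ is homotopic (through maps of triples) to a section of $\pi$, and this section is unique up to homotopy of sections.
   Context: Tame function: let $X$ be a compact cobordism of manifolds with boundary, i.e. a compact smooth manifold with corners whose boundary is $\partial X=X_-\cup B\cup X_+$, with $X_-,X_+$ disjoint compact manifolds with boundary, $B$ the remaining part of the boundary (the closure of $\partial X\setminus(X_-\cup X_+)$), a manifold with boundary $\partial X_-\sqcup\partial X_+$, along which it meets $X_\pm$. A smooth function $\pi:X\to[s_-,s_+]$ is tame if: (i) the critical points of $\pi|_B:B\to[s_-,s_+]$ are isolated and have distinct critical values in $(s_-,s_+)$; (ii) $\pi$ is submersive; (iii) $X_-=\pi^{-1}(s_-)$ and $X_+=\pi^{-1}(s_+)$. Here $s_-=a$, $s_+=b$. A critical point $q\in B$ of $\pi|_B$ is of type D if $d\pi(\eta)>0$ for an outward pointing vector $\eta\in T_qX$ (and of type N if $d\pi(\eta)<0$). A path $([a,b],a,b)\to(X,\pi^{-1}(a),\pi^{-1}(b))$ is a continuous map $\gamma:[a,b]\to X$ with $\gamma(a)\in\pi^{-1}(a)$ and $\gamma(b)\in\pi^{-1}(b)$. A homotopy of sections is a homotopy $H:[a,b]\times[0,1]\to X$ such that each $H(\cdot,t)$ is a section of $\pi$. The map $\pi$ is $0$-sectional if the inclusion of the space of sections of $\pi$ into the space of such paths induces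 a bijection on $\pi_0$. *)

theory Defs
  imports "HOL-Analysis.Analysis"
begin

section \<open>Smooth maps between subsets of Euclidean spaces\<close>

primrec Ck_on :: "nat \<Rightarrow> ('e::euclidean_space \<Rightarrow> 'f::euclidean_space) \<Rightarrow> 'e set \<Rightarrow> bool" where
  "Ck_on 0 f S \<longleftrightarrow> continuous_on S f"
| "Ck_on (Suc k) f S \<longleftrightarrow>
     (\<forall>x\<in>S. f differentiable (at x)) \<and>
     (\<forall>v. Ck_on k (\<lambda>x. frechet_derivative f (at x) v) S)"

text \<open>On a set that need not be open, smooth means: locally the restriction of a map
  that is smooth on an open set.\<close>

definition smooth_within :: "'e::euclidean_space set \<Rightarrow> ('e \<Rightarrow> 'f::euclidean_space) \<Rightarrow> bool" where
  "smooth_within S f \<longleftrightarrow>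
     (\<forall>x\<in>S. \<exists>V g. open V \<and> x \<in> V \<and> (\<forall>k. Ck_on k g V) \<and> (\<forall>y\<in>S \<inter> V. g y = f y))"

section \<open>Smooth manifolds with corners\<close>

text \<open>A chart is a pair of a domain and a coordinate map; only the values of the coordinate map
  on the domain matter. The local model is the orthant, whose open subsets include open subsets of
  all the products \<open>[0,\<infinity>)^k \<times> \<real>^(n-k)\<close> up to translation. Since \<^typ>\<open>'n\<close> is nonempty, the
  dimension is at least 1.\<close>

type_synonym ('a, 'n) chart = "'a set \<times> ('a \<Rightarrow> real ^ 'n)"

definition orthant :: "(real ^ 'n) set" where
  "orthant = {x. \<forall>i. 0 \<le> x $ i}"

definition chart_on :: "'a topology \<Rightarrow> ('a, 'n::finite) chart \<Rightarrow> bool" where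
  "chart_on X = (\<lambda>(U, \<phi>).
     openin X U \<and> openin (top_of_set orthant) (\<phi> ` U) \<and>
     homeomorphic_map (subtopology X U) (top_of_set (\<phi> ` U)) \<phi>)"

definition smooth_transition :: "('a, 'n::finite) chart \<Rightarrow> ('a, 'n) chart \<Rightarrow> bool" where
  "smooth_transition = (\<lambda>(U, \<phi>) (V, \<psi>). smooth_within (\<phi> ` (U \<inter> V)) (\<psi> \<circ> inv_into U \<phi>))"

definition smooth_atlas :: "'a topology \<Rightarrow> ('a, 'n::finite) chart set \<Rightarrow> bool" where
  "smooth_atlas X A \<longleftrightarrow>
     (\<forall>c\<in>A. chart_on X c) \<and>
     (\<forall>c\<in>A. \<forall>d\<in>A. smooth_transition c d) \<and>
     topspace X \<subseteq> (\<Union>c\<in>A. fst c)"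

text \<open>The maximal atlas (smooth structure) determined by an atlas.\<close>

definition smooth_charts :: "'a topology \<Rightarrow> ('a, 'n::finite) chart set \<Rightarrow> ('a, 'n) chart set" where
  "smooth_charts X A =
     {c. chart_on X c \<and> (\<forall>d\<in>A. smooth_transition c d \<and> smooth_transition d c)}"

definition manifold_with_corners :: "'a topology \<Rightarrow> ('a, 'n::finite) chart set \<Rightarrow> bool" where
  "manifold_with_corners X A \<longleftrightarrow>
     Hausdorff_space X \<and> second_countable X \<and> smooth_atlas X A"

definition mfd_boundary :: "'a topology \<Rightarrow> ('a, 'n::finite) chart set \<Rightarrow> 'a set" where
  "mfd_boundary X A =
     {p \<in> topspace X. \<exists>U \<phi>. (U, \<phi>) \<in> smooth_charts X A \<and> p \<in> U \<and> (\<exists>i. \<phi> p $ i = 0)}"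

definition smooth_function :: "'a topology \<Rightarrow> ('a, 'n::finite) chart set \<Rightarrow> ('a \<Rightarrow> real) \<Rightarrow> bool" where
  "smooth_function X A f \<longleftrightarrow>
     (\<forall>(U, \<phi>)\<in>smooth_charts X A. smooth_within (\<phi> ` U) (f \<circ> inv_into U \<phi>))"

text \<open>Tangent vectors at a point are represented by their coordinates in a chart, so the tangent
  space is the whole of \<^typ>\<open>real ^ 'n\<close> also at boundary points. The differential in a chart is
  unique, because a nonempty relatively open subset of the orthant contains, near each of its
  points, enough directions to span.\<close>

definition differential_in :: "('a, 'n::finite) chart \<Rightarrow> 'a \<Rightarrow> ('a \<Rightarrow> real) \<Rightarrow> (real ^ 'n \<Rightarrow> real) \<Rightarrow> bool" where
  "differential_in = (\<lambda>(U, \<phi>) p f D.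
     ((f \<circ> inv_into U \<phi>) has_derivative D) (at (\<phi> p) within \<phi> ` U))"

definition submersive :: "'a topology \<Rightarrow> ('a, 'n::finite) chart set \<Rightarrow> ('a \<Rightarrow> real) \<Rightarrow> bool" where
  "submersive X A f \<longleftrightarrow>
     (\<forall>(U, \<phi>)\<in>smooth_charts X A. \<forall>p\<in>U. \<exists>D. differential_in (U, \<phi>) p f D \<and> surj D)"

section \<open>Hypersurfaces contained in the boundary\<close>

text \<open>In a chart adapted to \<open>Y\<close>, the set \<open>Y\<close> is the face on which the \<open>i\<close>-th coordinate vanishes.
  The remaining coordinates are then a chart of \<open>Y\<close> into an orthant of dimension one less, and the
  tangent space of \<open>Y\<close> consists of the vectors with vanishing \<open>i\<close>-th coordinate.\<close>

definition adapted_chart ::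
  "'a topology \<Rightarrow> ('a, 'n::finite) chart set \<Rightarrow> 'a set \<Rightarrow> ('a, 'n) chart \<Rightarrow> 'n \<Rightarrow> bool" where
  "adapted_chart X A Y = (\<lambda>(U, \<phi>) i.
     (U, \<phi>) \<in> smooth_charts X A \<and> Y \<inter> U = {x \<in> U. \<phi> x $ i = 0})"

text \<open>The number of further vanishing coordinates at \<open>p\<close> is the codimension of the corner of \<open>Y\<close>
  at \<open>p\<close>: it is at most 1 everywhere if and only if \<open>Y\<close> is a manifold with boundary, and it is 1
  exactly at the boundary points of \<open>Y\<close>.\<close>

definition hypersurface_with_boundary ::
  "'a topology \<Rightarrow> ('a, 'n::finite) chart set \<Rightarrow> 'a set \<Rightarrow> bool" where
  "hypersurface_with_boundary X A Y \<longleftrightarrow>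
     Y \<subseteq> topspace X \<and>
     (\<forall>p\<in>Y. \<exists>U \<phi> i. adapted_chart X A Y (U, \<phi>) i \<and> p \<in> U \<and> card {j. j \<noteq> i \<and> \<phi> p $ j = 0} \<le> 1)"

definition hypersurface_boundary ::
  "'a topology \<Rightarrow> ('a, 'n::finite) chart set \<Rightarrow> 'a set \<Rightarrow> 'a set" where
  "hypersurface_boundary X A Y =
     {p \<in> Y. \<exists>U \<phi> i. adapted_chart X A Y (U, \<phi>) i \<and> p \<in> U \<and> card {j. j \<noteq> i \<and> \<phi> p $ j = 0} = 1}"

definition critical_points_on ::
  "'a topology \<Rightarrow> ('a, 'n::finite) chart set \<Rightarrow> 'a set \<Rightarrow> ('a \<Rightarrow> real) \<Rightarrow> 'a set" where
  "critical_points_on X A Y f =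
     {q \<in> Y. \<exists>U \<phi> i D. adapted_chart X A Y (U, \<phi>) i \<and> q \<in> U \<and>
        differential_in (U, \<phi>) q f D \<and> (\<forall>v. v $ i = 0 \<longrightarrow> D v = 0)}"

section \<open>Cobordisms and tame functions\<close>

definition compact_cobordism ::
  "'a topology \<Rightarrow> ('a, 'n::finite) chart set \<Rightarrow> 'a set \<Rightarrow> 'a set \<Rightarrow> 'a set \<Rightarrow> bool" where
  "compact_cobordism X A Xm B Xp \<longleftrightarrow>
     manifold_with_corners X A \<and> compact_space X \<and>
     mfd_boundary X A = Xm \<union> B \<union> Xp \<and>
     Xm \<inter> Xp = {} \<and>
     compactin X Xm \<and> hypersurface_with_boundary X A Xm \<and>
     compactin X Xp \<and> hypersurface_with_boundary X A Xp \<and>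
     B = X closure_of (mfd_boundary X A - (Xm \<union> Xp)) \<and>
     hypersurface_with_boundary X A B \<and>
     hypersurface_boundary X A B = hypersurface_boundary X A Xm \<union> hypersurface_boundary X A Xp \<and>
     B \<inter> Xm = hypersurface_boundary X A Xm \<and>
     B \<inter> Xp = hypersurface_boundary X A Xp"

definition tame ::
  "'a topology \<Rightarrow> ('a, 'n::finite) chart set \<Rightarrow> 'a set \<Rightarrow> 'a set \<Rightarrow> 'a set \<Rightarrow>
     real \<Rightarrow> real \<Rightarrow> ('a \<Rightarrow> real) \<Rightarrow> bool" where
  "tame X A Xm B Xp a b f \<longleftrightarrow>
     smooth_function X A f \<and> f ` topspace X \<subseteq> {a..b} \<and>
     (\<forall>q\<in>critical_points_on X A B f.
        \<exists>W. openin X W \<and> W \<inter> critical_points_on X A B f = {q}) \<and>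
     inj_on f (critical_points_on X A B f) \<and>
     f ` critical_points_on X A B f \<subseteq> {a<..<b} \<and>
     submersive X A f \<and>
     Xm = {p \<in> topspace X. f p = a} \<and>
     Xp = {p \<in> topspace X. f p = b}"

text \<open>A tangent vector at a boundary point points outward if, in a chart, it has a negative
  component in the direction of a vanishing coordinate (coordinates being nonnegative on the
  manifold). Critical points of a tame function on \<open>B\<close> lie off the corners, where exactly one
  coordinate vanishes.\<close>

definition critical_point_type_D ::
  "'a topology \<Rightarrow> ('a, 'n::finite) chart set \<Rightarrow> 'a set \<Rightarrow> ('a \<Rightarrow> real) \<Rightarrow> 'a \<Rightarrow> bool" where
  "critical_point_type_D X A B f q \<longleftrightarrow>
     q \<in> critical_points_on X A B f \<and>
     (\<exists>U \<phi> i D \<eta>. (U, \<phi>) \<in> smooth_charts X A \<and> q \<in> U \<and> differential_in (U, \<phi>) q f D \<and>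
        \<phi> q $ i = 0 \<and> \<eta> $ i < 0 \<and> D \<eta> > 0)"

section \<open>Sections, paths and path components of mapping spaces\<close>

definition triple_path :: "'a topology \<Rightarrow> real \<Rightarrow> real \<Rightarrow> ('a \<Rightarrow> real) \<Rightarrow> (real \<Rightarrow> 'a) \<Rightarrow> bool" where
  "triple_path X a b f \<gamma> \<longleftrightarrow>
     continuous_map (top_of_set {a..b}) X \<gamma> \<and> f (\<gamma> a) = a \<and> f (\<gamma> b) = b"

definition section_of :: "'a topology \<Rightarrow> real \<Rightarrow> real \<Rightarrow> ('a \<Rightarrow> real) \<Rightarrow> (real \<Rightarrow> 'a) \<Rightarrow> bool" where
  "section_of X a b f \<sigma> \<longleftrightarrow>
     continuous_map (top_of_set {a..b}) X \<sigma> \<and> (\<forall>s\<in>{a..b}. f (\<sigma> s) = s)"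

text \<open>The space of continuous maps with the compact-open topology. Maps are made unique by
  requiring them to be \<^const>\<open>undefined\<close> off the domain.\<close>

definition compact_open_topology :: "'s topology \<Rightarrow> 'a topology \<Rightarrow> ('s \<Rightarrow> 'a) topology" where
  "compact_open_topology S X = topology_generated_by
     {{g \<in> extensional (topspace S). continuous_map S X g \<and> g ` K \<subseteq> V} | K V.
        compactin S K \<and> openin X V}"

definition path_space :: "'a topology \<Rightarrow> real \<Rightarrow> real \<Rightarrow> ('a \<Rightarrow> real) \<Rightarrow> (real \<Rightarrow> 'a) topology" where
  "path_space X a b f =
     subtopology (compact_open_topology (top_of_set {a..b}) X) {\<gamma>. triple_path X a b f \<gamma>}"

definition section_space :: "'a topology \<Rightarrow> real \<Rightarrow> real \<Rightarrow> ('a \<Rightarrow> real) \<Rightarrow> (real \<Rightarrow> 'a) topology" where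
  "section_space X a b f =
     subtopology (compact_open_topology (top_of_set {a..b}) X) {\<sigma>. section_of X a b f \<sigma>}"

text \<open>The map induced on sets of path components by the inclusion of a subspace of \<open>P\<close>.\<close>

definition pi0_inclusion :: "'b topology \<Rightarrow> 'b set \<Rightarrow> 'b set" where
  "pi0_inclusion P C = (THE D. D \<in> path_components_of P \<and> C \<subseteq> D)"

definition zero_sectional :: "'a topology \<Rightarrow> real \<Rightarrow> real \<Rightarrow> ('a \<Rightarrow> real) \<Rightarrow> bool" where
  "zero_sectional X a b f \<longleftrightarrow>
     bij_betw (pi0_inclusion (path_space X a b f))
       (path_components_of (section_space X a b f))
       (path_components_of (path_space X a b f))"

end

theory Submission
  imports Defs
begin

text \<open>
  The theorem reduces to one construction: a continuous map \<open>\<Psi>\<close> that moves every point \<open>x\<close> of \<open>X\<close>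
  downwards to any prescribed level \<open>u \<le> \<pi> x\<close>, starting from \<open>\<Psi> (x, \<pi> x) = x\<close> (\<open>descent\<close>). It is
  the time-reversed substitute for the flow of a gradient-like vector field. Such a vector field cannot
  be tangent to \<open>B\<close> at the critical point, but a downward field only has to point inwards, so that its
  \<^emph>\<open>semiflow\<close> stays in \<open>X\<close>. Type D says exactly that the outward direction ascends, that is, that the
  inward direction descends.

  Given \<open>\<Psi>\<close>, every \<open>p\<close> in the top fibre spans the section \<open>s \<mapsto> \<Psi> (p, s)\<close>. A path \<open>\<gamma>\<close> is homotopic to the
  section spanned by its end point \<open>\<gamma> b\<close>: first push \<open>\<gamma> s\<close> down to level at most \<open>s\<close>, then replace
  \<open>\<Psi> (\<gamma> s, s)\<close> by \<open>\<Psi> (\<gamma> b, s)\<close> through \<open>\<Psi> (\<gamma> (max s r), s)\<close>. If \<open>\<gamma>\<close> is a section, the second homotopy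
  runs through sections and its start is \<open>\<gamma>\<close> itself. So path components of sections and of paths are both
  the path components of the fibre over \<open>b\<close>, through evaluation at \<open>b\<close>, which is continuous for the
  compact-open topology.

  The descent is glued from local pieces. A
  \<open>lowering\<close> map moves points down, but never below the prescribed level; near a point it may reach this level
  exactly for all small drops (\<open>exact_near\<close>). Lowering maps can be composed, and exactness near a point
  survives composition on either side, so finitely many local ones compose to a map that
  is exact for all drops of a uniform size, and iterating it gives \<open>\<Psi>\<close>
  (\<open>descent_from_local_lowerings\<close>).

  Locally, a lowering map slides points of a chart along straight lines \<open>x + s v\<close> until the level is
  reached (\<open>lowering_in_chart\<close>). This works if \<open>v\<close> does not leave the orthant and the differential of
  \<open>\<pi>\<close> is negative on \<open>v\<close>. In the interior and on the top fibre such a \<open>v\<close> exists because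
  \<open>\<pi>\<close> is submersive, and at a noncritical point of \<open>B\<close> over the open interval it can be chosen
  tangent to \<open>B\<close>. At the critical point it comes from type D, once that condition has been carried to an adapted chart (\<open>type_D_outward_ascent\<close>). On the
  bottom fibre \<open>v\<close> points out of the orthant, but the slide stops at level \<open>a\<close> exactly when it meets
  the face (\<open>lowering_onto_bottom_face\<close>).
\<close>

section \<open>Lowering maps\<close>

definition lowering :: "'a topology \<Rightarrow> real \<Rightarrow> real \<Rightarrow> ('a \<Rightarrow> real) \<Rightarrow> ('a \<times> real \<Rightarrow> 'a) \<Rightarrow> bool" where
  "lowering X a b f G \<longleftrightarrow>
     continuous_map (prod_topology X (top_of_set {a..b})) X G \<and>
     (\<forall>x\<in>topspace X. \<forall>u\<in>{a..b}.
        (f x \<le> u \<longrightarrow> G (x, u) = x) \<and> (u \<le> f x \<longrightarrow> f (G (x, u)) \<in> {u..f x}))"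

text \<open>Exactness is asked for on a whole neighbourhood of \<open>p\<close>, because a map composed before \<open>G\<close> moves the
  point that \<open>G\<close> is applied to.\<close>

definition exact_near :: "'a topology \<Rightarrow> real \<Rightarrow> real \<Rightarrow> ('a \<Rightarrow> real) \<Rightarrow> ('a \<times> real \<Rightarrow> 'a) \<Rightarrow> 'a \<Rightarrow> bool" where
  "exact_near X a b f G p \<longleftrightarrow>
     (\<exists>N \<delta>. openin X N \<and> p \<in> N \<and> 0 < \<delta> \<and>
        (\<forall>x\<in>N. \<forall>u\<in>{a..b}. f x - \<delta> \<le> u \<longrightarrow> u \<le> f x \<longrightarrow> f (G (x, u)) = u))"

text \<open>A lowering map that is exact everywhere, for drops of any size.\<close>

definition descent :: "'a topology \<Rightarrow> real \<Rightarrow> real \<Rightarrow> ('a \<Rightarrow> real) \<Rightarrow> ('a \<times> real \<Rightarrow> 'a) \<Rightarrow> bool" where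
  "descent X a b f \<Psi> \<longleftrightarrow>
     continuous_map (prod_topology X (top_of_set {a..b})) X \<Psi> \<and>
     (\<forall>x\<in>topspace X. \<forall>u\<in>{a..b}. f (\<Psi> (x, u)) = min u (f x) \<and> (f x \<le> u \<longrightarrow> \<Psi> (x, u) = x))"

lemma exact_nearI:
  assumes "openin X N" "p \<in> N" "0 < \<delta>"
    "\<And>x u. x \<in> N \<Longrightarrow> u \<in> {a..b} \<Longrightarrow> f x - \<delta> \<le> u \<Longrightarrow> u \<le> f x \<Longrightarrow> f (G (x, u)) = u"
  shows "exact_near X a b f G p"
  unfolding exact_near_def using assms by blast

lemma exact_nearE:
  assumes "exact_near X a b f G p"
  obtains N \<delta> where "openin X N" "p \<in> N" "0 < \<delta>"
    "\<And>x u. x \<in> N \<Longrightarrow> u \<in> {a..b} \<Longrightarrow> f x - \<delta> \<le> u \<Longrightarrow> u \<le> f x \<Longrightarrow> f (G (x, u)) = u"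
  using assms unfolding exact_near_def by blast

lemma lowering_in_topspace:
  assumes "lowering X a b f G" "x \<in> topspace X" "u \<in> {a..b}"
  shows "G (x, u) \<in> topspace X"
proof -
  have "continuous_map (prod_topology X (top_of_set {a..b})) X G" using assms(1) by (simp add: lowering_def)
  then have "G \<in> topspace (prod_topology X (top_of_set {a..b})) \<rightarrow> topspace X"
    unfolding continuous_map_def by (rule conjunct1)
  then show ?thesis using assms(2,3) by auto
qed

lemma lowering_continuous:
  "lowering X a b f G \<Longrightarrow> continuous_map (prod_topology X (top_of_set {a..b})) X G"
  by (simp add: lowering_def)

lemma lowering_fixes:
  "lowering X a b f G \<Longrightarrow> x \<in> topspace X \<Longrightarrow> u \<in> {a..b} \<Longrightarrow> f x \<le> u \<Longrightarrow> G (x, u) = x"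
  unfolding lowering_def by blast

lemma lowering_between:
  assumes "lowering X a b f G" "x \<in> topspace X" "u \<in> {a..b}" "u \<le> f x"
  shows "u \<le> f (G (x, u))" "f (G (x, u)) \<le> f x"
proof -
  have "f (G (x, u)) \<in> {u..f x}" using assms unfolding lowering_def by blast
  then show "u \<le> f (G (x, u))" "f (G (x, u)) \<le> f x" by auto
qed

lemma lowering_fst: "lowering X a b f fst"
  by (auto simp: lowering_def continuous_map_fst)

lemma lowering_comp:
  assumes G: "lowering X a b f G" and H: "lowering X a b f H"
  shows "lowering X a b f (\<lambda>z. G (H z, snd z))"
  unfolding lowering_def
proof (intro conjI ballI impI)
  let ?P = "prod_topology X (top_of_set {a..b})"
  have "continuous_map ?P ?P (\<lambda>z. (H z, snd z))"
    by (intro continuous_map_pairedI continuous_map_snd lowering_continuous[OF H])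
  from continuous_map_compose[OF this lowering_continuous[OF G]]
  show "continuous_map ?P X (\<lambda>z. G (H z, snd z))"
    by (simp add: o_def)
  fix x u assume x: "x \<in> topspace X" and u: "u \<in> {a..b}"
  show "G (H (x, u), snd (x, u)) = x" if "f x \<le> u"
    using lowering_fixes[OF H x u that] lowering_fixes[OF G x u that] by simp
  show "f (G (H (x, u), snd (x, u))) \<in> {u..f x}" if le: "u \<le> f x"
    using lowering_between[OF G lowering_in_topspace[OF H x u] u lowering_between(1)[OF H x u le]]
      lowering_between(2)[OF H x u le] by simp
qed

text \<open>Once \<open>H\<close> has reached the prescribed level, a second lowering map with the same level can only fix the point.\<close>

lemma exact_near_comp_right:
  assumes G: "lowering X a b f G" and H: "lowering X a b f H" and ex: "exact_near X a b f H p"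
  shows "exact_near X a b f (\<lambda>z. G (H z, snd z)) p"
proof -
  obtain N \<delta> where N: "openin X N" "p \<in> N" "0 < \<delta>"
    and e: "\<And>x u. x \<in> N \<Longrightarrow> u \<in> {a..b} \<Longrightarrow> f x - \<delta> \<le> u \<Longrightarrow> u \<le> f x \<Longrightarrow> f (H (x, u)) = u"
    using exact_nearE[OF ex] by blast
  show ?thesis
  proof (rule exact_nearI[OF N])
    fix x u assume x: "x \<in> N" and u: "u \<in> {a..b}" "f x - \<delta> \<le> u" "u \<le> f x"
    have "x \<in> topspace X" using N(1) x openin_subset by blast
    then have "H (x, u) \<in> topspace X" using lowering_in_topspace[OF H] u by blast
    from lowering_between[OF G this u(1)] show "f (G (H (x, u), snd (x, u))) = u"
      using e[OF x u] by simp
  qed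
qed

text \<open>A small drop moves points near \<open>p\<close> only a little, by continuity of \<open>H\<close> at \<open>(p, f p)\<close>, so that \<open>G\<close> still acts
  on its domain of exactness and completes whatever \<open>H\<close> has left of the drop.\<close>

lemma exact_near_comp_left:
  assumes G: "lowering X a b f G" and H: "lowering X a b f H" and ex: "exact_near X a b f G p"
    and f: "continuous_map X euclideanreal f" and p: "f p \<in> {a..b}"
  shows "exact_near X a b f (\<lambda>z. G (H z, snd z)) p"
proof -
  obtain N \<delta> where N: "openin X N" "p \<in> N" "0 < \<delta>"
    and e: "\<And>x u. x \<in> N \<Longrightarrow> u \<in> {a..b} \<Longrightarrow> f x - \<delta> \<le> u \<Longrightarrow> u \<le> f x \<Longrightarrow> f (G (x, u)) = u"
    using exact_nearE[OF ex] by blast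
  have pX: "p \<in> topspace X" using N openin_subset by blast
  let ?P = "prod_topology X (top_of_set {a..b})"
  have "openin ?P {z \<in> topspace ?P. H z \<in> N}"
    by (intro openin_continuous_map_preimage[OF lowering_continuous[OF H]] N)
  moreover have "(p, f p) \<in> {z \<in> topspace ?P. H z \<in> N}"
    using pX p lowering_fixes[OF H pX p] N(2) by simp
  ultimately have "\<exists>N' T. openin X N' \<and> openin (top_of_set {a..b}) T \<and> p \<in> N' \<and> f p \<in> T \<and>
      N' \<times> T \<subseteq> {z \<in> topspace ?P. H z \<in> N}"
    unfolding openin_prod_topology_alt by (elim allE impE)
  then obtain N' T where NT: "openin X N'" "openin (top_of_set {a..b}) T" "p \<in> N'" "f p \<in> T"
      "N' \<times> T \<subseteq> {z \<in> topspace ?P. H z \<in> N}"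
    by (elim exE conjE)
  then obtain e0 where e0: "e0 > 0" "ball (f p) e0 \<inter> {a..b} \<subseteq> T"
    by (metis openin_contains_ball)
  \<comment> \<open>halves of \<open>e0\<close> for the distances of \<open>f x\<close> from \<open>f p\<close> and of \<open>u\<close> from \<open>f x\<close>\<close>
  define N'' where "N'' = N' \<inter> {x \<in> topspace X. f x \<in> ball (f p) (e0/2)}"
  define d where "d = min \<delta> (e0/2)"
  show ?thesis
  proof (rule exact_nearI)
    show "openin X N''" unfolding N''_def
      by (intro openin_Int NT openin_continuous_map_preimage[OF f]) simp
    show "p \<in> N''" using NT(3) e0(1) pX by (simp add: N''_def)
    show "d > 0" using e0(1) N(3) by (simp add: d_def)
    fix x u assume x: "x \<in> N''" and u: "u \<in> {a..b}" "f x - d \<le> u" "u \<le> f x"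
    have xX: "x \<in> topspace X" and xN: "x \<in> N'" and fx: "\<bar>f p - f x\<bar> < e0/2"
      using x by (auto simp: N''_def dist_real_def)
    have "d \<le> e0/2" "d \<le> \<delta>" by (auto simp: d_def)
    then have "u \<in> ball (f p) e0"
      using fx u by (simp add: dist_real_def abs_if split: if_splits)
    then have "(x, u) \<in> N' \<times> T" using e0(2) u(1) xN by blast
    then have HN: "H (x, u) \<in> N" using NT(5) by blast
    note b = lowering_between[OF H xX u(1) u(3)]
    have "f (H (x, u)) - \<delta> \<le> u" using b u \<open>d \<le> \<delta>\<close> by linarith
    from e[OF HN u(1) this b(1)] show "f (G (H (x, u), snd (x, u))) = u" by simp
  qed
qed

lemma exact_near_everywhere:
  assumes X: "compact_space X" and f: "continuous_map X euclideanreal f"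
    and fab: "f ` topspace X \<subseteq> {a..b}"
    and loc: "\<And>p. p \<in> topspace X \<Longrightarrow> \<exists>G. lowering X a b f G \<and> exact_near X a b f G p"
  shows "\<exists>G. lowering X a b f G \<and> (\<forall>p\<in>topspace X. exact_near X a b f G p)"
proof -
  have "\<forall>p\<in>topspace X. \<exists>N. openin X N \<and> p \<in> N \<and>
          (\<exists>G. lowering X a b f G \<and> (\<forall>x\<in>N. exact_near X a b f G x))"
  proof
    fix p assume "p \<in> topspace X"
    then obtain G where G: "lowering X a b f G" "exact_near X a b f G p" using loc by blast
    from exact_nearE[OF G(2)] obtain N \<delta> where N: "openin X N" "p \<in> N" "0 < \<delta>"
      "\<And>x u. x \<in> N \<Longrightarrow> u \<in> {a..b} \<Longrightarrow> f x - \<delta> \<le> u \<Longrightarrow> u \<le> f x \<Longrightarrow> f (G (x, u)) = u"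
      by blast
    have "\<forall>x\<in>N. exact_near X a b f G x"
      using exact_nearI[OF N(1) _ N(3,4)] by blast
    with G N show "\<exists>N. openin X N \<and> p \<in> N \<and>
          (\<exists>G. lowering X a b f G \<and> (\<forall>x\<in>N. exact_near X a b f G x))" by blast
  qed
  from bchoice[OF this] obtain N where N': "\<forall>p\<in>topspace X. openin X (N p) \<and> p \<in> N p \<and>
          (\<exists>G. lowering X a b f G \<and> (\<forall>x\<in>N p. exact_near X a b f G x))" ..
  note N = N'[rule_format]
  have "\<exists>\<F>. finite \<F> \<and> \<F> \<subseteq> N ` topspace X \<and> topspace X \<subseteq> \<Union>\<F>"
    using X[unfolded compact_space_def] by (rule compactinD) (use N in auto)
  then obtain F where F: "finite F" "F \<subseteq> topspace X" "topspace X \<subseteq> \<Union>(N ` F)"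
    by (metis finite_subset_image)
  have "\<exists>G. lowering X a b f G \<and> (\<forall>x\<in>\<Union>(N ` F). exact_near X a b f G x)"
    using F(1,2)
  proof (induction F rule: finite_induct)
    case empty
    show ?case using lowering_fst by blast
  next
    case (insert p F)
    have "\<exists>H. lowering X a b f H \<and> (\<forall>x\<in>\<Union>(N ` F). exact_near X a b f H x)"
      using insert.prems by (intro insert.IH) simp
    then obtain H where H: "lowering X a b f H" "\<forall>x\<in>\<Union>(N ` F). exact_near X a b f H x"
      by (elim exE conjE)
    have "p \<in> topspace X" using insert.prems by simp
    from N[OF this] obtain G where G: "lowering X a b f G" "\<forall>x\<in>N p. exact_near X a b f G x"
      by (elim exE conjE)
    have "N p \<subseteq> topspace X" using N[OF \<open>p \<in> topspace X\<close>] by (simp add: openin_subset)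
    then have "exact_near X a b f (\<lambda>z. G (H z, snd z)) x" if "x \<in> \<Union>(N ` insert p F)" for x
    proof (cases "x \<in> N p")
      case True
      then have "f x \<in> {a..b}" using fab \<open>N p \<subseteq> topspace X\<close> by blast
      with True show ?thesis using exact_near_comp_left[OF G(1) H(1)] G(2) f by blast
    next
      case False
      then have "exact_near X a b f H x" using that H(2) by blast
      then show ?thesis by (rule exact_near_comp_right[OF G(1) H(1)])
    qed
    then show ?case using lowering_comp[OF G(1) H(1)] by (intro exI conjI ballI)
  qed
  then obtain G where G: "lowering X a b f G" "\<forall>x\<in>\<Union>(N ` F). exact_near X a b f G x"
    by (elim exE conjE)
  have "\<forall>p\<in>topspace X. exact_near X a b f G p" using G(2) F(3) by (meson subsetD)
  with G(1) show ?thesis by (intro exI[of _ G] conjI)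
qed

lemma uniform_exactness:
  assumes X: "compact_space X" and ex: "\<And>p. p \<in> topspace X \<Longrightarrow> exact_near X a b f G p"
  shows "\<exists>\<delta>>0. \<forall>x\<in>topspace X. \<forall>u\<in>{a..b}. f x - \<delta> \<le> u \<longrightarrow> u \<le> f x \<longrightarrow> f (G (x, u)) = u"
proof -
  have "\<forall>p\<in>topspace X. \<exists>N \<delta>. openin X N \<and> p \<in> N \<and> 0 < \<delta> \<and>
        (\<forall>x\<in>N. \<forall>u\<in>{a..b}. f x - \<delta> \<le> u \<longrightarrow> u \<le> f x \<longrightarrow> f (G (x, u)) = u)"
    by (intro ballI ex[unfolded exact_near_def])
  from bchoice[OF this] obtain N where
    "\<forall>p\<in>topspace X. \<exists>\<delta>. openin X (N p) \<and> p \<in> N p \<and> 0 < \<delta> \<and>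
        (\<forall>x\<in>N p. \<forall>u\<in>{a..b}. f x - \<delta> \<le> u \<longrightarrow> u \<le> f x \<longrightarrow> f (G (x, u)) = u)" ..
  from bchoice[OF this] obtain \<delta> where "\<forall>p\<in>topspace X. openin X (N p) \<and> p \<in> N p \<and> 0 < \<delta> p \<and>
        (\<forall>x\<in>N p. \<forall>u\<in>{a..b}. f x - \<delta> p \<le> u \<longrightarrow> u \<le> f x \<longrightarrow> f (G (x, u)) = u)" ..
  note N = this[rule_format]
  have "\<exists>\<F>. finite \<F> \<and> \<F> \<subseteq> N ` topspace X \<and> topspace X \<subseteq> \<Union>\<F>"
    using X[unfolded compact_space_def] by (rule compactinD) (use N in auto)
  then obtain F where F: "finite F" "F \<subseteq> topspace X" "topspace X \<subseteq> \<Union>(N ` F)"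
    by (metis finite_subset_image)
  define d where "d = Min (insert 1 (\<delta> ` F))"
  have d: "d \<le> \<delta> p" if "p \<in> F" for p using that F by (auto simp: d_def)
  have "d > 0" using F N by (auto simp: d_def)
  moreover have "f (G (x, u)) = u" if x: "x \<in> topspace X" and u: "u \<in> {a..b}" "f x - d \<le> u" "u \<le> f x" for x u
  proof -
    obtain p where p: "p \<in> F" "x \<in> N p" using F(3) x by blast
    then have "f x - \<delta> p \<le> u" using d[of p] u by linarith
    then show ?thesis using N[of p] F(2) p u by blast
  qed
  ultimately show ?thesis by (intro exI[of _ d]) simp
qed

text \<open>Local lowering maps need not be compatible. Composing finitely many of them gives one map that is exact for
  drops up to some \<open>\<delta>\<close>, and \<open>k\<close> such drops in succession are exact for drops up to \<open>k \<delta>\<close>.\<close>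

lemma descent_from_local_lowerings:
  assumes X: "compact_space X" and f: "continuous_map X euclideanreal f" and ab: "a \<le> b"
    and fab: "f ` topspace X \<subseteq> {a..b}"
    and loc: "\<And>p. p \<in> topspace X \<Longrightarrow> \<exists>G. lowering X a b f G \<and> exact_near X a b f G p"
  shows "\<exists>\<Psi>. descent X a b f \<Psi>"
proof -
  obtain G where G: "lowering X a b f G" "\<forall>p\<in>topspace X. exact_near X a b f G p"
    using exact_near_everywhere[OF X f fab loc] by blast
  obtain \<delta> where \<delta>: "\<delta> > 0"
    and ex: "\<And>x u. x \<in> topspace X \<Longrightarrow> u \<in> {a..b} \<Longrightarrow> f x - \<delta> \<le> u \<Longrightarrow> u \<le> f x \<Longrightarrow> f (G (x, u)) = u"
    using uniform_exactness[of X a b f G] X G(2) by blast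
  let ?P = "prod_topology X (top_of_set {a..b})"
  have contG: "continuous_map ?P X G" using G by (simp add: lowering_def)
  have range: "f x \<in> {a..b}" if "x \<in> topspace X" for x using fab that by blast
  have step: "\<exists>\<Psi>. lowering X a b f \<Psi> \<and>
      (\<forall>x\<in>topspace X. \<forall>u\<in>{a..b}. u \<le> f x \<longrightarrow> f (\<Psi> (x, u)) = max u (f x - real k * \<delta>))" for k
  proof (induction k)
    case 0
    show ?case using lowering_fst by (intro exI[of _ fst]) auto
  next
    case (Suc k)
    then obtain \<Psi> where \<Psi>: "lowering X a b f \<Psi>"
      "\<And>x u. x \<in> topspace X \<Longrightarrow> u \<in> {a..b} \<Longrightarrow> u \<le> f x \<Longrightarrow> f (\<Psi> (x, u)) = max u (f x - real k * \<delta>)"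
      by blast
    \<comment> \<open>continue from where the first \<open>k\<close> drops ended, but by at most \<open>\<delta>\<close>\<close>
    define \<Phi> where "\<Phi> = (\<lambda>z. G (\<Psi> z, max (snd z) (f (\<Psi> z) - \<delta>)))"
    have cont\<Psi>: "continuous_map ?P X \<Psi>" using \<Psi> by (simp add: lowering_def)
    have cf: "continuous_map ?P euclideanreal (\<lambda>z. f (\<Psi> z))"
      using continuous_map_compose[OF cont\<Psi> f] by (simp add: o_def)
    have cs: "continuous_map ?P euclideanreal snd"
      using continuous_map_snd continuous_map_into_fulltopology by blast
    have in\<Psi>: "\<Psi> z \<in> topspace X" if "z \<in> topspace ?P" for z
      using that lowering_in_topspace[OF \<Psi>(1)] by (cases z) auto
    have "continuous_map ?P ?P (\<lambda>z. (\<Psi> z, max (snd z) (f (\<Psi> z) - \<delta>)))"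
    proof (intro continuous_map_pairedI continuous_map_into_subtopology continuous_map_real_max cs
        continuous_map_diff cf cont\<Psi>)
      show "continuous_map ?P euclideanreal (\<lambda>x. \<delta>)" by simp
      show "(\<lambda>z. max (snd z) (f (\<Psi> z) - \<delta>)) \<in> topspace ?P \<rightarrow> {a..b}"
        using in\<Psi> range \<delta> by (force simp: max_def)
    qed
    then have cont: "continuous_map ?P X \<Phi>"
      using continuous_map_compose[OF _ contG, of ?P "\<lambda>z. (\<Psi> z, max (snd z) (f (\<Psi> z) - \<delta>))"]
      by (simp add: \<Phi>_def o_def)
    have val: "f (\<Phi> (x, u)) = max u (f x - real (Suc k) * \<delta>)"
      if x: "x \<in> topspace X" and u: "u \<in> {a..b}" "u \<le> f x" for x u
    proof -
      have y: "\<Psi> (x, u) \<in> topspace X" using lowering_in_topspace[OF \<Psi>(1) x u(1)] .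
      have fy: "f (\<Psi> (x, u)) = max u (f x - real k * \<delta>)" using \<Psi>(2) x u by blast
      have "f (\<Phi> (x, u)) = max u (f (\<Psi> (x, u)) - \<delta>)"
        unfolding \<Phi>_def snd_conv using range[OF y] u \<delta> fy by (intro ex y) auto
      then show ?thesis using fy \<delta> by (auto simp: algebra_simps max_def)
    qed
    have "lowering X a b f \<Phi>"
      unfolding lowering_def
    proof (intro conjI cont ballI impI)
      fix x u assume x: "x \<in> topspace X" and u: "u \<in> {a..b}"
      show "\<Phi> (x, u) = x" if "f x \<le> u"
        using that \<delta> lowering_fixes[OF G(1) x u that] lowering_fixes[OF \<Psi>(1) x u that]
        by (simp add: \<Phi>_def max_def)
      show "f (\<Phi> (x, u)) \<in> {u..f x}" if "u \<le> f x"
        using val[OF x u that] \<delta> that by auto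
    qed
    then show ?case using val by blast
  qed
  obtain k where k: "b - a \<le> real k * \<delta>" using \<delta> reals_Archimedean3 less_imp_le by blast
  obtain \<Psi> where \<Psi>: "lowering X a b f \<Psi>"
      "\<And>x u. x \<in> topspace X \<Longrightarrow> u \<in> {a..b} \<Longrightarrow> u \<le> f x \<Longrightarrow> f (\<Psi> (x, u)) = max u (f x - real k * \<delta>)"
    using step by blast
  have "descent X a b f \<Psi>"
    unfolding descent_def
  proof (intro conjI ballI impI)
    show "continuous_map ?P X \<Psi>" using \<Psi> by (simp add: lowering_def)
    fix x u assume x: "x \<in> topspace X" and u: "u \<in> {a..b}"
    show fix1: "\<Psi> (x, u) = x" if "f x \<le> u" using that by (intro lowering_fixes[OF \<Psi>(1) x u])
    show "f (\<Psi> (x, u)) = min u (f x)"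
    proof (cases "u \<le> f x")
      case True
      have "f x - real k * \<delta> \<le> u" using range[OF x] u k by auto
      then show ?thesis using \<Psi>(2)[OF x u True] True by auto
    qed (use fix1 in auto)
  qed
  then show ?thesis by blast
qed

section \<open>Homotopies obtained from a descent\<close>

lemma continuous_map_descent:
  assumes "descent X a b f \<Psi>" "continuous_map Z X g" "continuous_map Z euclideanreal h"
    "\<And>z. z \<in> topspace Z \<Longrightarrow> h z \<in> {a..b}"
  shows "continuous_map Z X (\<lambda>z. \<Psi> (g z, h z))"
proof -
  have "continuous_map Z (prod_topology X (top_of_set {a..b})) (\<lambda>z. (g z, h z))"
    using assms by (intro continuous_map_pairedI continuous_map_into_subtopology) auto
  from continuous_map_compose[OF this, of X \<Psi>] show ?thesis
    using assms(1) by (simp add: descent_def o_def)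
qed

text \<open>Paths and sections matter on \<open>{a..b}\<close> only. This is what lets homotopies through them be rewritten, below, with
  conditions on the interval alone, and lets maps be normalised to be undefined off the interval.\<close>

lemma triple_path_cong:
  assumes "a \<le> b" "\<And>s. s \<in> {a..b} \<Longrightarrow> h s = k s"
  shows "triple_path X a b f h \<longleftrightarrow> triple_path X a b f k"
proof -
  have "continuous_map (top_of_set {a..b}) X h \<longleftrightarrow> continuous_map (top_of_set {a..b}) X k"
    using assms(2) continuous_map_eq[of "top_of_set {a..b}" X h k]
      continuous_map_eq[of "top_of_set {a..b}" X k h] by auto
  then show ?thesis using assms by (simp add: triple_path_def)
qed

lemma section_of_cong:
  assumes "\<And>s. s \<in> {a..b} \<Longrightarrow> h s = k s"
  shows "section_of X a b f h \<longleftrightarrow> section_of X a b f k"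
proof -
  have "continuous_map (top_of_set {a..b}) X h \<longleftrightarrow> continuous_map (top_of_set {a..b}) X k"
    using assms continuous_map_eq[of "top_of_set {a..b}" X h k]
      continuous_map_eq[of "top_of_set {a..b}" X k h] by auto
  then show ?thesis using assms by (simp add: section_of_def)
qed

lemma homotopic_with_triple_path_iff:
  assumes "a \<le> b"
  shows "homotopic_with (triple_path X a b f) (top_of_set {a..b}) X p q \<longleftrightarrow>
     (\<exists>h. continuous_map (prod_topology (top_of_set {0..1::real}) (top_of_set {a..b})) X h \<and>
        (\<forall>s\<in>{a..b}. h (0, s) = p s) \<and> (\<forall>s\<in>{a..b}. h (1, s) = q s) \<and>
        (\<forall>t\<in>{0..1}. triple_path X a b f (\<lambda>s. h (t, s))))"
  by (subst homotopic_with, rule triple_path_cong[OF assms]) simp_all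

lemma homotopic_with_section_of_iff:
  shows "homotopic_with (section_of X a b f) (top_of_set {a..b}) X p q \<longleftrightarrow>
     (\<exists>h. continuous_map (prod_topology (top_of_set {0..1::real}) (top_of_set {a..b})) X h \<and>
        (\<forall>s\<in>{a..b}. h (0, s) = p s) \<and> (\<forall>s\<in>{a..b}. h (1, s) = q s) \<and>
        (\<forall>t\<in>{0..1}. section_of X a b f (\<lambda>s. h (t, s))))"
  by (subst homotopic_with, rule section_of_cong) simp_all

lemma descent_level:
  "descent X a b f \<Psi> \<Longrightarrow> x \<in> topspace X \<Longrightarrow> u \<in> {a..b} \<Longrightarrow> f (\<Psi> (x, u)) = min u (f x)"
  unfolding descent_def by blast

lemma descent_fixes:
  "descent X a b f \<Psi> \<Longrightarrow> x \<in> topspace X \<Longrightarrow> u \<in> {a..b} \<Longrightarrow> f x \<le> u \<Longrightarrow> \<Psi> (x, u) = x"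
  unfolding descent_def by blast

lemma section_of_triple_path:
  assumes "a \<le> b" "section_of X a b f \<sigma>"
  shows "triple_path X a b f \<sigma>"
  using assms by (simp add: section_of_def triple_path_def)

lemma continuous_map_time_param:
  fixes S :: "real set"
  assumes \<gamma>: "continuous_map (top_of_set {a..b}) X \<gamma>"
    and g: "continuous_on (S \<times> {a..b}) g" "\<And>z. z \<in> S \<times> {a..b} \<Longrightarrow> g z \<in> {a..b}"
  shows "continuous_map (prod_topology (top_of_set S) (top_of_set {a..b})) X (\<lambda>z. \<gamma> (g z))"
proof -
  have "continuous_map (top_of_set (S \<times> {a..b})) (top_of_set {a..b}) g"
    using g by (intro continuous_map_into_subtopology) auto
  from continuous_map_compose[OF this \<gamma>] show ?thesis by (simp add: o_def)
qed

lemma descent_section: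
  assumes \<Psi>: "descent X a b f \<Psi>" and x: "x \<in> topspace X" "f x = b"
  shows "section_of X a b f (\<lambda>s. \<Psi> (x, s))"
  unfolding section_of_def
proof (intro conjI ballI)
  show "continuous_map (top_of_set {a..b}) X (\<lambda>s. \<Psi> (x, s))"
    using x by (intro continuous_map_descent[OF \<Psi>]) auto
  show "f (\<Psi> (x, s)) = s" if "s \<in> {a..b}" for s
    using descent_level[OF \<Psi> x(1) that] x that by auto
qed

text \<open>First \<open>\<gamma>\<close> is pushed down to \<open>\<Psi> (\<gamma> s, s)\<close>, then the point that is pushed down is moved along \<open>\<gamma>\<close> to the
  end. The ends stay in their fibres: points over \<open>a\<close> cannot be lowered further, and nothing happens at parameter
  \<open>b\<close>.\<close>

lemma path_homotopic_descent_section: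
  assumes ab: "a < b" and fab: "f ` topspace X \<subseteq> {a..b}" and \<Psi>: "descent X a b f \<Psi>"
    and \<gamma>: "triple_path X a b f \<gamma>"
  shows "homotopic_with (triple_path X a b f) (top_of_set {a..b}) X \<gamma> (\<lambda>s. \<Psi> (\<gamma> b, s))"
proof -
  let ?I = "prod_topology (top_of_set {0..1::real}) (top_of_set {a..b})"
  have c\<gamma>: "continuous_map (top_of_set {a..b}) X \<gamma>" and ends: "f (\<gamma> a) = a" "f (\<gamma> b) = b"
    using \<gamma> by (auto simp: triple_path_def)
  have top: "\<gamma> s \<in> topspace X" if "s \<in> {a..b}" for s
    using c\<gamma> that by (auto simp: continuous_map_def Pi_iff)
  have le: "f (\<gamma> s) \<in> {a..b}" if "s \<in> {a..b}" for s using top[OF that] fab by blast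
  have conv: "a + r * (b - a) \<in> {a..b}" if "r \<in> {0..1}" for r
  proof -
    have "0 \<le> r * (b - a)" "r * (b - a) \<le> 1 * (b - a)"
      using that ab by (auto intro!: mult_right_mono)
    then show ?thesis by auto
  qed
  have conv': "b - r * (b - a) \<in> {a..b}" if "r \<in> {0..1}" for r
    using conv[OF that] by auto
  have 1: "homotopic_with (triple_path X a b f) (top_of_set {a..b}) X \<gamma> (\<lambda>s. \<Psi> (\<gamma> s, s))"
    unfolding homotopic_with_triple_path_iff[OF less_imp_le[OF ab]]
  proof (intro exI conjI ballI)
    let ?h = "\<lambda>z. \<Psi> (\<gamma> (snd z), max (snd z) (b - fst z * (b - a)))"
    have ran: "max (snd z) (b - fst z * (b - a)) \<in> {a..b}" if "z \<in> {0..1} \<times> {a..b}" for z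
      using that conv'[of "fst z"] by (cases z) (auto simp: max_def)
    show "continuous_map ?I X ?h"
    proof (rule continuous_map_descent[OF \<Psi>])
      show "continuous_map ?I X (\<lambda>z. \<gamma> (snd z))"
        by (rule continuous_map_time_param[OF c\<gamma>]) (auto intro!: continuous_intros)
      show "continuous_map ?I euclideanreal (\<lambda>z. max (snd z) (b - fst z * (b - a)))"
        by (simp, intro continuous_intros)
    qed (use ran in auto)
    show "?h (0, s) = \<gamma> s" if "s \<in> {a..b}" for s
      using descent_fixes[OF \<Psi> top[OF that], of b] le[OF that] that ab by (auto simp: max_def)
    show "?h (1, s) = \<Psi> (\<gamma> s, s)" if "s \<in> {a..b}" for s
      using that by (auto simp: max_def)
    fix r :: real assume r: "r \<in> {0..1}"
    have "?h (r, a) = \<gamma> a"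
      using descent_fixes[OF \<Psi> top[of a]] ran[of "(r, a)"] ends ab r by auto
    moreover have "?h (r, b) = \<gamma> b"
      using descent_fixes[OF \<Psi> top[of b]] ran[of "(r, b)"] ends ab r by auto
    moreover have "continuous_map (top_of_set {a..b}) X (\<lambda>s. ?h (r, s))"
    proof (rule continuous_map_descent[OF \<Psi>])
      show "continuous_map (top_of_set {a..b}) X (\<lambda>s. \<gamma> (snd (r, s)))"
        using c\<gamma> by simp
      show "continuous_map (top_of_set {a..b}) euclideanreal
              (\<lambda>s. max (snd (r, s)) (b - fst (r, s) * (b - a)))"
        by (simp, intro continuous_intros)
    qed (use ran r in auto)
    ultimately show "triple_path X a b f (\<lambda>s. ?h (r, s))"
      using ends by (simp add: triple_path_def)
  qed
  have 2: "homotopic_with (triple_path X a b f) (top_of_set {a..b}) X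
             (\<lambda>s. \<Psi> (\<gamma> s, s)) (\<lambda>s. \<Psi> (\<gamma> b, s))"
    unfolding homotopic_with_triple_path_iff[OF less_imp_le[OF ab]]
  proof (intro exI conjI ballI)
    let ?m = "\<lambda>z. max (snd z) (a + fst z * (b - a))"
    let ?h = "\<lambda>z. \<Psi> (\<gamma> (?m z), snd z)"
    have ran: "?m z \<in> {a..b}" if "z \<in> {0..1} \<times> {a..b}" for z
      using that conv[of "fst z"] by (cases z) (auto simp: max_def)
    have mcont: "continuous_on ({0..1} \<times> {a..b}) ?m" by (intro continuous_intros)
    show hcont: "continuous_map ?I X ?h"
    proof (rule continuous_map_descent[OF \<Psi>])
      show "continuous_map ?I X (\<lambda>z. \<gamma> (?m z))"
        by (rule continuous_map_time_param[OF c\<gamma> mcont ran])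
      show "continuous_map ?I euclideanreal snd"
        by (simp, intro continuous_intros)
    qed auto
    show "?h (0, s) = \<Psi> (\<gamma> s, s)" if "s \<in> {a..b}" for s
      using that by (auto simp: max_def)
    show "?h (1, s) = \<Psi> (\<gamma> b, s)" if "s \<in> {a..b}" for s
      using that by (auto simp: max_def)
    fix r :: real assume r: "r \<in> {0..1}"
    have "f (?h (r, a)) = a"
      using descent_level[OF \<Psi> top, of "?m (r, a)" a] le[OF ran, of "(r, a)"] ran[of "(r, a)"] r ab by auto
    moreover have "?m (r, b) = b"
      using ran[of "(r, b)"] r ab by auto
    then have "f (?h (r, b)) = b"
      using descent_level[OF \<Psi> top, of b b] ends ab by auto
    moreover have "continuous_map (top_of_set {a..b}) X (\<lambda>s. ?h (r, s))"
    proof -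
      have "continuous_map (top_of_set {a..b}) ?I (\<lambda>s. (r, s))"
        using r by (intro continuous_map_pairedI) auto
      from continuous_map_compose[OF this hcont] show ?thesis by (simp add: o_def)
    qed
    ultimately show "triple_path X a b f (\<lambda>s. ?h (r, s))"
      by (simp add: triple_path_def)
  qed
  show ?thesis by (rule homotopic_with_trans[OF 1 2])
qed

text \<open>The second of the two homotopies for paths, now starting at \<open>\<Psi> (\<sigma> s, s) = \<sigma> s\<close>. Every stage is a section since
  \<open>\<sigma> (max s r)\<close> has level at least \<open>s\<close>, whence lowering it to level \<open>s\<close> succeeds.\<close>

lemma section_homotopic_descent_section:
  assumes ab: "a < b" and \<Psi>: "descent X a b f \<Psi>" and \<sigma>: "section_of X a b f \<sigma>"
  shows "homotopic_with (section_of X a b f) (top_of_set {a..b}) X \<sigma> (\<lambda>s. \<Psi> (\<sigma> b, s))"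
  unfolding homotopic_with_section_of_iff
proof (intro exI conjI ballI)
  let ?I = "prod_topology (top_of_set {0..1::real}) (top_of_set {a..b})"
  let ?m = "\<lambda>z. max (snd z) (a + fst z * (b - a))"
  let ?h = "\<lambda>z. \<Psi> (\<sigma> (?m z), snd z)"
  have c\<sigma>: "continuous_map (top_of_set {a..b}) X \<sigma>" and f\<sigma>: "\<And>s. s \<in> {a..b} \<Longrightarrow> f (\<sigma> s) = s"
    using \<sigma> by (auto simp: section_of_def)
  have top: "\<sigma> s \<in> topspace X" if "s \<in> {a..b}" for s
    using c\<sigma> that by (auto simp: continuous_map_def Pi_iff)
  have ran: "?m z \<in> {a..b}" if "z \<in> {0..1} \<times> {a..b}" for z
  proof -
    have "0 \<le> fst z * (b - a)" "fst z * (b - a) \<le> 1 * (b - a)"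
      using that ab by (auto intro!: mult_right_mono)
    then show ?thesis using that by auto
  qed
  have mcont: "continuous_on ({0..1} \<times> {a..b}) ?m" by (intro continuous_intros)
  show hcont: "continuous_map ?I X ?h"
  proof (rule continuous_map_descent[OF \<Psi>])
    show "continuous_map ?I X (\<lambda>z. \<sigma> (?m z))"
      by (rule continuous_map_time_param[OF c\<sigma> mcont ran])
    show "continuous_map ?I euclideanreal snd"
      by (simp, intro continuous_intros)
  qed auto
  show "?h (0, s) = \<sigma> s" if "s \<in> {a..b}" for s
    using that descent_fixes[OF \<Psi> top[OF that] that] f\<sigma>[OF that] by (auto simp: max_def)
  show "?h (1, s) = \<Psi> (\<sigma> b, s)" if "s \<in> {a..b}" for s
    using that by (auto simp: max_def)
  fix r :: real assume r: "r \<in> {0..1}"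
  have "continuous_map (top_of_set {a..b}) ?I (\<lambda>s. (r, s))"
    using r by (intro continuous_map_pairedI) auto
  from continuous_map_compose[OF this hcont]
  have "continuous_map (top_of_set {a..b}) X (\<lambda>s. ?h (r, s))" by (simp add: o_def)
  moreover have "f (?h (r, s)) = s" if s: "s \<in> {a..b}" for s
    using descent_level[OF \<Psi> top[OF ran] s, of "(r, s)"] f\<sigma>[OF ran, of "(r, s)"] r s by auto
  ultimately show "section_of X a b f (\<lambda>s. ?h (r, s))"
    by (simp add: section_of_def)
qed

lemma descent_sections_homotopic:
  assumes \<Psi>: "descent X a b f \<Psi>" and c: "pathin X c" "\<And>r. r \<in> {0..1} \<Longrightarrow> f (c r) = b"
  shows "homotopic_with (section_of X a b f) (top_of_set {a..b}) X (\<lambda>s. \<Psi> (c 0, s)) (\<lambda>s. \<Psi> (c 1, s))"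
  unfolding homotopic_with_section_of_iff
proof (intro exI conjI ballI)
  let ?I = "prod_topology (top_of_set {0..1::real}) (top_of_set {a..b})"
  let ?h = "\<lambda>z. \<Psi> (c (fst z), snd z)"
  have cc: "continuous_map (top_of_set {0..1}) X c" using c by (simp add: pathin_def)
  show "continuous_map ?I X ?h"
  proof (rule continuous_map_descent[OF \<Psi>])
    show "continuous_map ?I X (\<lambda>z. c (fst z))"
      using continuous_map_compose[OF continuous_map_fst cc] unfolding o_def .
    show "continuous_map ?I euclideanreal snd"
      by (simp, intro continuous_intros)
  qed auto
  fix r :: real assume r: "r \<in> {0..1}"
  then have "c r \<in> topspace X" using cc by (auto simp: continuous_map_def Pi_iff)
  then show "section_of X a b f (\<lambda>s. ?h (r, s))"
    using descent_section[OF \<Psi>] c(2)[OF r] by simp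
qed auto

lemma triple_path_end:
  assumes "a \<le> b" "triple_path X a b f \<gamma>"
  shows "\<gamma> b \<in> topspace X" "f (\<gamma> b) = b"
  using assms by (auto simp: triple_path_def continuous_map_def Pi_iff)

text \<open>Both sections are homotopic to the sections spanned by their end points over \<open>b\<close>, and these move along with the
  end point. This carries the uniqueness and the injectivity on path components.\<close>

lemma sections_homotopic_if_ends_connected:
  assumes ab: "a < b" and \<Psi>: "descent X a b f \<Psi>"
    and \<sigma>: "section_of X a b f \<sigma>" and \<tau>: "section_of X a b f \<tau>"
    and c: "pathin X c" "\<And>r. r \<in> {0..1} \<Longrightarrow> f (c r) = b" "c 0 = \<sigma> b" "c 1 = \<tau> b"
  shows "homotopic_with (section_of X a b f) (top_of_set {a..b}) X \<sigma> \<tau>"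
proof -
  have "homotopic_with (section_of X a b f) (top_of_set {a..b}) X (\<lambda>s. \<Psi> (\<sigma> b, s)) (\<lambda>s. \<Psi> (\<tau> b, s))"
    using descent_sections_homotopic[OF \<Psi> c(1,2)] c(3,4) by simp
  then show ?thesis
    using section_homotopic_descent_section[OF ab \<Psi>] \<sigma> \<tau>
    by (metis homotopic_with_trans homotopic_with_sym)
qed

lemma homotopic_sections_if_homotopic_paths:
  assumes ab: "a < b" and \<Psi>: "descent X a b f \<Psi>"
    and \<sigma>: "section_of X a b f \<sigma>" and \<tau>: "section_of X a b f \<tau>"
    and hom: "homotopic_with (triple_path X a b f) (top_of_set {a..b}) X \<sigma> \<tau>"
  shows "homotopic_with (section_of X a b f) (top_of_set {a..b}) X \<sigma> \<tau>"
proof -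
  let ?I = "prod_topology (top_of_set {0..1::real}) (top_of_set {a..b})"
  obtain h where h: "continuous_map ?I X h" "\<forall>s\<in>{a..b}. h (0, s) = \<sigma> s" "\<forall>s\<in>{a..b}. h (1, s) = \<tau> s"
    "\<forall>t\<in>{0..1}. triple_path X a b f (\<lambda>s. h (t, s))"
    using hom unfolding homotopic_with_triple_path_iff[OF less_imp_le[OF ab]] by (elim exE conjE)
  have "continuous_map (top_of_set {0..1::real}) ?I (\<lambda>r. (r, b))"
    using ab by (intro continuous_map_pairedI) auto
  from continuous_map_compose[OF this h(1)] have "pathin X (\<lambda>r. h (r, b))"
    by (simp add: pathin_def o_def)
  moreover have "f (h (r, b)) = b" if "r \<in> {0..1}" for r
    using h(4) that by (auto simp: triple_path_def)
  ultimately show ?thesis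
    using h(2,3) ab by (intro sections_homotopic_if_ends_connected[OF ab \<Psi> \<sigma> \<tau>, of "\<lambda>r. h (r, b)"]) auto
qed

section \<open>Path components of mapping spaces\<close>

text \<open>The whole space is itself a subbasic open set: take \<open>K\<close> empty.\<close>

lemma topspace_compact_open_topology:
  "topspace (compact_open_topology S X) = {g \<in> extensional (topspace S). continuous_map S X g}"
proof -
  have "{g \<in> extensional (topspace S). continuous_map S X g} =
      {g \<in> extensional (topspace S). continuous_map S X g \<and> g ` {} \<subseteq> {}}" by simp
  then show ?thesis
    unfolding compact_open_topology_def topology_generated_by_topspace by blast
qed

text \<open>The half of the exponential law that holds for every \<open>S\<close>; its proof is the tube lemma.\<close>

lemma continuous_map_curry:
  assumes h: "continuous_map (prod_topology T S) X h"
  shows "continuous_map T (compact_open_topology S X) (\<lambda>t. restrict (\<lambda>s. h (t, s)) (topspace S))"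
    (is "continuous_map _ _ ?c")
  unfolding compact_open_topology_def
proof (rule continuous_on_generated_topo)
  have cont: "continuous_map S X (?c t)" if t: "t \<in> topspace T" for t
  proof -
    have "continuous_map S (prod_topology T S) (\<lambda>s. (t, s))"
      using t by (intro continuous_map_pairedI) auto
    from continuous_map_compose[OF this h] have "continuous_map S X (\<lambda>s. h (t, s))" by (simp add: o_def)
    then show ?thesis by (rule continuous_map_eq) simp
  qed
  show "?c ` topspace T \<subseteq> \<Union> {{g \<in> extensional (topspace S). continuous_map S X g \<and> g ` K \<subseteq> V} |K V.
           compactin S K \<and> openin X V}"
    using cont topspace_compact_open_topology[of S X]
    unfolding compact_open_topology_def topology_generated_by_topspace by auto
  fix U assume "U \<in> {{g \<in> extensional (topspace S). continuous_map S X g \<and> g ` K \<subseteq> V} |K V.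
           compactin S K \<and> openin X V}"
  then obtain K V where K: "compactin S K" and V: "openin X V"
    and U: "U = {g \<in> extensional (topspace S). continuous_map S X g \<and> g ` K \<subseteq> V}" by blast
  have KS: "K \<subseteq> topspace S" using K compactin_subset_topspace by blast
  let ?W = "{z \<in> topspace (prod_topology T S). h z \<in> V}"
  have W: "openin (prod_topology T S) ?W" by (rule openin_continuous_map_preimage[OF h V])
  have mem: "?c t \<in> U \<longleftrightarrow> (\<forall>s\<in>K. h (t, s) \<in> V)" if "t \<in> topspace T" for t
    using cont[OF that] KS by (auto simp: U)
  show "openin T (?c -` U \<inter> topspace T)"
  proof (subst openin_subopen, intro ballI)
    fix t assume t: "t \<in> ?c -` U \<inter> topspace T"
    then have "{t} \<times> K \<subseteq> ?W" using mem[of t] KS by auto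
    from tube_lemma_right[OF W K _ this] t obtain A B where
      AB: "openin T A" "openin S B" "t \<in> A" "K \<subseteq> B" "A \<times> B \<subseteq> ?W" by blast
    have "A \<subseteq> ?c -` U \<inter> topspace T"
    proof
      fix t' assume t': "t' \<in> A"
      then have t'T: "t' \<in> topspace T" using AB(1) openin_subset by blast
      have "h (t', s) \<in> V" if "s \<in> K" for s using AB(4,5) t' that by blast
      then show "t' \<in> ?c -` U \<inter> topspace T" using mem[OF t'T] t'T by simp
    qed
    then show "\<exists>A. openin T A \<and> t \<in> A \<and> A \<subseteq> ?c -` U \<inter> topspace T" using AB by blast
  qed
qed

lemma continuous_map_evaluation:
  assumes "s \<in> topspace S"
  shows "continuous_map (compact_open_topology S X) X (\<lambda>g. g s)"
  unfolding continuous_map_def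
proof (intro conjI allI impI)
  show "(\<lambda>g. g s) \<in> topspace (compact_open_topology S X) \<rightarrow> topspace X"
    using assms by (auto simp: topspace_compact_open_topology continuous_map_def Pi_iff)
  fix V assume V: "openin X V"
  have "{g \<in> topspace (compact_open_topology S X). g s \<in> V} =
        {g \<in> extensional (topspace S). continuous_map S X g \<and> g ` {s} \<subseteq> V}"
    by (auto simp: topspace_compact_open_topology)
  moreover have "openin (compact_open_topology S X)
        {g \<in> extensional (topspace S). continuous_map S X g \<and> g ` {s} \<subseteq> V}"
    unfolding compact_open_topology_def using V assms
    by (intro topology_generated_by_Basis CollectI exI[of _ "{s}"] exI[of _ V]) auto
  ultimately show "openin (compact_open_topology S X) {g \<in> topspace (compact_open_topology S X). g s \<in> V}"
    by simp
qed

lemma homotopic_with_imp_path_component: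
  assumes hom: "homotopic_with P S X p q"
    and P: "\<And>h k. (\<And>s. s \<in> topspace S \<Longrightarrow> h s = k s) \<Longrightarrow> P h \<longleftrightarrow> P k"
  shows "path_component_of (subtopology (compact_open_topology S X) {g. P g})
           (restrict p (topspace S)) (restrict q (topspace S))"
proof -
  obtain h where h: "continuous_map (prod_topology (top_of_set {0..1::real}) S) X h"
    "\<forall>s\<in>topspace S. h (0, s) = p s" "\<forall>s\<in>topspace S. h (1, s) = q s"
    "\<forall>t\<in>{0..1}. P (\<lambda>s. h (t, s))"
    using hom homotopic_with[of S P X p q, OF P] by auto
  have "P (restrict (\<lambda>s. h (t, s)) (topspace S))" if "t \<in> {0..1}" for t
    using h(4) that P[of "restrict (\<lambda>s. h (t, s)) (topspace S)" "\<lambda>s. h (t, s)"] by simp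
  then have "pathin (subtopology (compact_open_topology S X) {g. P g})
          (\<lambda>t. restrict (\<lambda>s. h (t, s)) (topspace S))"
    unfolding pathin_subtopology using continuous_map_curry[OF h(1)] by (simp add: pathin_def)
  moreover have "restrict (\<lambda>s. h (0, s)) (topspace S) = restrict p (topspace S)"
    "restrict (\<lambda>s. h (1, s)) (topspace S) = restrict q (topspace S)"
    using h(2,3) by (auto simp: restrict_def)
  ultimately show ?thesis unfolding path_component_of_def by blast
qed

lemma topspace_path_space:
  "topspace (path_space X a b f) = {\<gamma> \<in> extensional {a..b}. triple_path X a b f \<gamma>}"
  by (auto simp: path_space_def topspace_compact_open_topology triple_path_def)

lemma topspace_section_space:
  "topspace (section_space X a b f) = {\<sigma> \<in> extensional {a..b}. section_of X a b f \<sigma>}"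
  by (auto simp: section_space_def topspace_compact_open_topology section_of_def)

lemma path_component_section_imp_path_space:
  assumes "a \<le> b" "path_component_of (section_space X a b f) \<sigma> \<tau>"
  shows "path_component_of (path_space X a b f) \<sigma> \<tau>"
  using assms section_of_triple_path[of a b X f]
  unfolding path_component_of_def section_space_def path_space_def pathin_subtopology by blast

text \<open>For a subspace \<open>S\<close> of \<open>P\<close> the first hypothesis holds automatically; it makes \<^const>\<open>pi0_inclusion\<close>, which
  is a definite description, well defined.\<close>

lemma bij_betw_pi0_inclusion:
  assumes sub: "\<And>x y. path_component_of S x y \<Longrightarrow> path_component_of P x y"
    and inj: "\<And>x y. x \<in> topspace S \<Longrightarrow> y \<in> topspace S \<Longrightarrow> path_component_of P x y \<Longrightarrow> path_component_of S x y"
    and surj: "\<And>y. y \<in> topspace P \<Longrightarrow> \<exists>x\<in>topspace S. path_component_of P y x"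
  shows "bij_betw (pi0_inclusion P) (path_components_of S) (path_components_of P)"
proof -
  have incl: "pi0_inclusion P (path_component_of_set S x) = path_component_of_set P x"
    if x: "x \<in> topspace S" for x
    unfolding pi0_inclusion_def
  proof (rule the_equality)
    have xx: "path_component_of S x x" using x by (simp add: path_component_of_refl)
    have xP: "x \<in> topspace P" using path_component_in_topspace[OF sub[OF xx]] by simp
    show "path_component_of_set P x \<in> path_components_of P \<and>
        path_component_of_set S x \<subseteq> path_component_of_set P x"
      using xP sub by (auto simp: path_components_of_def)
    fix D assume D: "D \<in> path_components_of P \<and> path_component_of_set S x \<subseteq> D"
    then obtain y where y: "y \<in> topspace P" "D = path_component_of_set P y"
      by (auto simp: path_components_of_def)
    have "path_component_of P y x" using D y xx by auto
    then show "D = path_component_of_set P x" using y by (metis path_component_of_equiv)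
  qed
  show ?thesis
  proof (rule bij_betw_imageI)
    show "inj_on (pi0_inclusion P) (path_components_of S)"
    proof (rule inj_onI)
      fix C D assume C: "C \<in> path_components_of S" and D: "D \<in> path_components_of S"
        and eq: "pi0_inclusion P C = pi0_inclusion P D"
      obtain x where x: "x \<in> topspace S" "C = path_component_of_set S x" 
        using C by (auto simp: path_components_of_def)
      obtain y where y: "y \<in> topspace S" "D = path_component_of_set S y" 
        using D by (auto simp: path_components_of_def)
      have "path_component_of_set P x = path_component_of_set P y" using eq incl x y by simp
      moreover have "path_component_of P y y"
        by (rule sub[OF path_component_of_refl[THEN iffD2, OF y(1)]])
      ultimately have "path_component_of P x y" by blast
      then have "path_component_of S x y" using inj x y by blast
      then show "C = D" using x y by (metis path_component_of_equiv)
    qed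
    show "pi0_inclusion P ` path_components_of S = path_components_of P"
    proof
      show "pi0_inclusion P ` path_components_of S \<subseteq> path_components_of P"
      proof
        fix D assume "D \<in> pi0_inclusion P ` path_components_of S"
        then obtain x where x: "x \<in> topspace S" "D = path_component_of_set P x"
          using incl by (auto simp: path_components_of_def)
        have "x \<in> topspace P"
          using path_component_in_topspace[OF sub[OF path_component_of_refl[THEN iffD2, OF x(1)]]] by simp
        then show "D \<in> path_components_of P" using x by (auto simp: path_components_of_def)
      qed
      show "path_components_of P \<subseteq> pi0_inclusion P ` path_components_of S"
      proof
        fix D assume "D \<in> path_components_of P"
        then obtain y where y: "y \<in> topspace P" "D = path_component_of_set P y"
          by (auto simp: path_components_of_def)
        obtain x where x: "x \<in> topspace S" "path_component_of P y x" using surj y by blast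
        have "D = path_component_of_set P x" using x(2) y by (metis path_component_of_equiv)
        then have "D = pi0_inclusion P (path_component_of_set S x)" using incl x by simp
        then show "D \<in> pi0_inclusion P ` path_components_of S"
          using x by (auto simp: path_components_of_def)
      qed
    qed
  qed
qed

lemma zero_sectional_of_descent:
  assumes ab: "a < b" and fab: "f ` topspace X \<subseteq> {a..b}" and \<Psi>: "descent X a b f \<Psi>"
  shows "zero_sectional X a b f"
  unfolding zero_sectional_def
proof (rule bij_betw_pi0_inclusion)
  have le: "a \<le> b" using ab by simp
  show "path_component_of (path_space X a b f) \<sigma> \<tau>" if "path_component_of (section_space X a b f) \<sigma> \<tau>" for \<sigma> \<tau>
    by (rule path_component_section_imp_path_space[OF le that])
  show "path_component_of (section_space X a b f) \<sigma> \<tau>"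
    if \<sigma>: "\<sigma> \<in> topspace (section_space X a b f)" and \<tau>: "\<tau> \<in> topspace (section_space X a b f)"
      and pc: "path_component_of (path_space X a b f) \<sigma> \<tau>" for \<sigma> \<tau>
  proof -
    have s: "section_of X a b f \<sigma>" "section_of X a b f \<tau>" 
      and e: "restrict \<sigma> {a..b} = \<sigma>" "restrict \<tau> {a..b} = \<tau>"
      using \<sigma> \<tau> by (auto simp: topspace_section_space extensional_restrict)
    obtain g where g: "pathin (path_space X a b f) g" "g 0 = \<sigma>" "g 1 = \<tau>"
      using pc unfolding path_component_of_def by blast
    have gp: "pathin (compact_open_topology (top_of_set {a..b}) X) g"
      "\<And>r. r \<in> {0..1} \<Longrightarrow> triple_path X a b f (g r)"
      using g(1) by (auto simp: path_space_def pathin_subtopology)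
    have "pathin X (\<lambda>r. g r b)"
      using pathin_compose[OF gp(1) continuous_map_evaluation[of b]] ab by (simp add: o_def)
    then have "homotopic_with (section_of X a b f) (top_of_set {a..b}) X \<sigma> \<tau>"
      using g(2,3) gp(2)
      by (intro sections_homotopic_if_ends_connected[OF ab \<Psi> s, of "\<lambda>r. g r b"]) (auto simp: triple_path_def)
    from homotopic_with_imp_path_component[OF this section_of_cong] show ?thesis
      by (simp add: e section_space_def)
  qed
  show "\<exists>\<sigma>\<in>topspace (section_space X a b f). path_component_of (path_space X a b f) \<gamma> \<sigma>"
    if \<gamma>: "\<gamma> \<in> topspace (path_space X a b f)" for \<gamma>
  proof -
    have t: "triple_path X a b f \<gamma>" and e: "restrict \<gamma> {a..b} = \<gamma>"
      using \<gamma> by (auto simp: topspace_path_space extensional_restrict)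
    let ?\<sigma> = "\<lambda>s. \<Psi> (\<gamma> b, s)"
    have "homotopic_with (triple_path X a b f) (top_of_set {a..b}) X \<gamma> ?\<sigma>"
      by (rule path_homotopic_descent_section[OF ab fab \<Psi> t])
    from homotopic_with_imp_path_component[OF this triple_path_cong[OF le]]
    have "path_component_of (path_space X a b f) \<gamma> (restrict ?\<sigma> {a..b})"
      by (simp add: e path_space_def)
    moreover have "section_of X a b f ?\<sigma>"
      using descent_section[OF \<Psi>] triple_path_end[OF le t] by blast
    then have "section_of X a b f (restrict ?\<sigma> {a..b})"
      using section_of_cong[of a b "restrict ?\<sigma> {a..b}" ?\<sigma> X f] by simp
    then have "restrict ?\<sigma> {a..b} \<in> topspace (section_space X a b f)"
      by (simp add: topspace_section_space)
    ultimately show ?thesis by blast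
  qed
qed

lemma path_homotopic_to_unique_section:
  assumes ab: "a < b" and fab: "f ` topspace X \<subseteq> {a..b}" and \<Psi>: "descent X a b f \<Psi>"
    and \<gamma>: "triple_path X a b f \<gamma>"
  shows "\<exists>\<sigma>. section_of X a b f \<sigma> \<and>
        homotopic_with (triple_path X a b f) (top_of_set {a..b}) X \<gamma> \<sigma> \<and>
        (\<forall>\<tau>. section_of X a b f \<tau> \<and>
              homotopic_with (triple_path X a b f) (top_of_set {a..b}) X \<gamma> \<tau> \<longrightarrow>
            homotopic_with (section_of X a b f) (top_of_set {a..b}) X \<sigma> \<tau>)"
proof (intro exI conjI allI impI)
  let ?\<sigma> = "\<lambda>s. \<Psi> (\<gamma> b, s)"
  show s: "section_of X a b f ?\<sigma>"
    using descent_section[OF \<Psi>] triple_path_end[OF less_imp_le[OF ab] \<gamma>] by blast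
  show h: "homotopic_with (triple_path X a b f) (top_of_set {a..b}) X \<gamma> ?\<sigma>"
    by (rule path_homotopic_descent_section[OF ab fab \<Psi> \<gamma>])
  fix \<tau> assume \<tau>: "section_of X a b f \<tau> \<and> homotopic_with (triple_path X a b f) (top_of_set {a..b}) X \<gamma> \<tau>"
  have "homotopic_with (triple_path X a b f) (top_of_set {a..b}) X ?\<sigma> \<tau>"
    using h \<tau> by (metis homotopic_with_trans homotopic_with_sym)
  then show "homotopic_with (section_of X a b f) (top_of_set {a..b}) X ?\<sigma> \<tau>"
    using homotopic_sections_if_homotopic_paths[OF ab \<Psi> s] \<tau> by blast
qed

section \<open>Lowering maps in a chart\<close>

definition decreasing_along :: "'e::real_vector \<Rightarrow> 'e set \<Rightarrow> ('e \<Rightarrow> real) \<Rightarrow> bool" where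
  "decreasing_along v K F \<longleftrightarrow> (\<forall>x\<in>K. \<forall>s>0. x + s *\<^sub>R v \<in> K \<longrightarrow> F (x + s *\<^sub>R v) < F x)"

text \<open>The points of \<open>K\<close> on the segment that starts at \<open>x\<close> in direction \<open>v\<close> and has length \<open>s0\<close> (in units of \<open>v\<close>):
  \<open>slide\<close> picks the one at level \<open>u\<close>. It is meaningful on \<open>slide_domain\<close> only.\<close>

definition slide :: "'e::euclidean_space set \<Rightarrow> ('e \<Rightarrow> real) \<Rightarrow> 'e \<Rightarrow> real \<Rightarrow> 'e \<times> real \<Rightarrow> 'e" where
  "slide K F v s0 = (\<lambda>(x, u). THE y. y \<in> K \<and> F y = u \<and> y - x \<in> (\<lambda>s. s *\<^sub>R v) ` {0..s0})"

definition slide_domain :: "'e::euclidean_space set \<Rightarrow> ('e \<Rightarrow> real) \<Rightarrow> 'e \<Rightarrow> real \<Rightarrow> ('e \<times> real) set" where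
  "slide_domain K F v s0 = {(x, u). \<exists>s\<in>{0..s0}. x + s *\<^sub>R v \<in> K \<and> F (x + s *\<^sub>R v) = u}"

lemma slide_unique:
  fixes F :: "'e::euclidean_space \<Rightarrow> real"
  assumes dec: "decreasing_along v K F"
    and y: "y \<in> K" "F y = u" "y - x \<in> (\<lambda>s. s *\<^sub>R v) ` {0..s0}"
    and z: "z \<in> K" "F z = u" "z - x \<in> (\<lambda>s. s *\<^sub>R v) ` {0..s0}"
  shows "y = z"
proof -
  obtain s t where st: "y - x = s *\<^sub>R v" "z - x = t *\<^sub>R v"
    using y(3) z(3) by (elim imageE) blast
  have s: "y = x + s *\<^sub>R v" using st(1) by (metis add.commute diff_add_cancel)
  have t: "z = x + t *\<^sub>R v" using st(2) by (metis add.commute diff_add_cancel)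
  have zy: "z = y + (t - s) *\<^sub>R v" and yz: "y = z + (s - t) *\<^sub>R v"
    by (auto simp: s t algebra_simps)
  consider "s < t" | "t < s" | "s = t" by linarith
  then show ?thesis
  proof cases
    case 1
    then have "F z < F y" using dec y(1) z(1) unfolding decreasing_along_def zy by simp
    then show ?thesis using y z by simp
  next
    case 2
    then have "F y < F z" using dec y(1) z(1) unfolding decreasing_along_def yz by simp
    then show ?thesis using y z by simp
  next
    case 3
    then show ?thesis by (simp add: s t)
  qed
qed

lemma slide_eqI:
  fixes F :: "'e::euclidean_space \<Rightarrow> real"
  assumes dec: "decreasing_along v K F"
    and y: "y \<in> K" "F y = u" "y - x \<in> (\<lambda>s. s *\<^sub>R v) ` {0..s0}"
  shows "slide K F v s0 (x, u) = y"
  unfolding slide_def prod.case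
proof (rule the_equality)
  show "y \<in> K \<and> F y = u \<and> y - x \<in> (\<lambda>s. s *\<^sub>R v) ` {0..s0}" using y by simp
  fix z assume z: "z \<in> K \<and> F z = u \<and> z - x \<in> (\<lambda>s. s *\<^sub>R v) ` {0..s0}"
  show "z = y"
    by (rule slide_unique[OF dec _ _ _ y]) (use z in \<open>simp_all only:\<close>)
qed

lemma slide_in:
  fixes F :: "'e::euclidean_space \<Rightarrow> real"
  assumes dec: "decreasing_along v K F"
    and z: "z \<in> slide_domain K F v s0"
  shows "slide K F v s0 z \<in> K" "F (slide K F v s0 z) = snd z"
    "slide K F v s0 z - fst z \<in> (\<lambda>s. s *\<^sub>R v) ` {0..s0}"
proof -
  obtain s where s: "s \<in> {0..s0}" "fst z + s *\<^sub>R v \<in> K" "F (fst z + s *\<^sub>R v) = snd z"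
    using z by (auto simp: slide_domain_def)
  have "slide K F v s0 (fst z, snd z) = fst z + s *\<^sub>R v"
  proof (rule slide_eqI[OF dec])
    show "fst z + s *\<^sub>R v - fst z \<in> (\<lambda>s. s *\<^sub>R v) ` {0..s0}"
      using imageI[OF s(1), of "\<lambda>s. s *\<^sub>R v"] by simp
  qed (use s in \<open>simp_all only:\<close>)
  then show "slide K F v s0 z \<in> K" "F (slide K F v s0 z) = snd z"
    "slide K F v s0 z - fst z \<in> (\<lambda>s. s *\<^sub>R v) ` {0..s0}"
    using s imageI[OF s(1), of "\<lambda>s. s *\<^sub>R v"] by simp_all
qed

text \<open>The graph is cut out by closed conditions and the values lie in a compact set, so the closed graph
  criterion applies.\<close>

lemma continuous_on_slide:
  fixes F :: "'e::euclidean_space \<Rightarrow> real"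
  assumes dec: "decreasing_along v K F"
    and K: "compact K" and F: "continuous_on K F"
  shows "continuous_on (slide_domain K F v s0) (slide K F v s0)"
proof -
  let ?D = "slide_domain K F v s0" and ?P = "slide K F v s0" and ?C = "(\<lambda>s. s *\<^sub>R v) ` {0..s0}"
  note P = slide_in[OF dec, where ?s0.0=s0]
  have "closed ?C" by (intro compact_imp_closed compact_continuous_image continuous_intros) auto
  have preim: "closedin (top_of_set A) {w \<in> A. h w \<in> B}"
    if "continuous_on A h" "closed B"
    for A and h :: "('e \<times> real) \<times> 'e \<Rightarrow> 'c::real_normed_vector" and B
  proof -
    have "{w \<in> A. h w \<in> B} = A \<inter> h -` B" by blast
    then show ?thesis using continuous_closedin_preimage[OF that] by simp
  qed
  have graph: "(\<lambda>z. Pair z (?P z)) ` ?D =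
      {w \<in> ?D \<times> K. snd w - fst (fst w) \<in> ?C} \<inter> {w \<in> ?D \<times> K. F (snd w) - snd (fst w) \<in> {0}}"
    (is "?L = ?R")
  proof (intro equalityI subsetI)
    fix w assume "w \<in> ?L"
    then obtain z where z: "z \<in> ?D" "w = (z, ?P z)" by blast
    then show "w \<in> ?R" using P[OF z(1)] by simp
  next
    fix w assume w: "w \<in> ?R"
    have "?P (fst (fst w), snd (fst w)) = snd w" using w by (intro slide_eqI[OF dec]) (simp_all add: mem_Times_iff)
    then have "w = (fst w, ?P (fst w))" by (simp add: prod_eq_iff)
    moreover have "fst w \<in> ?D" using w by (auto simp: mem_Times_iff)
    ultimately show "w \<in> ?L" by (rule image_eqI)
  qed
  have "closedin (top_of_set (?D \<times> K)) {w \<in> ?D \<times> K. snd w - fst (fst w) \<in> ?C}"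
    by (intro preim \<open>closed ?C\<close> continuous_intros)
  moreover have "closedin (top_of_set (?D \<times> K)) {w \<in> ?D \<times> K. F (snd w) - snd (fst w) \<in> {0}}"
    by (intro preim closed_singleton continuous_intros continuous_on_compose2[OF F]) (simp add: mem_Times_iff)
  ultimately have "closedin (top_of_set (?D \<times> K)) ((\<lambda>z. Pair z (?P z)) ` ?D)"
    unfolding graph by (rule closedin_Int)
  then show ?thesis
    by (subst continuous_closed_graph_eq[OF K]) (use P(1) in blast)+
qed

lemma chart_on_D:
  assumes "chart_on X (U, \<phi>)"
  shows chart_on_open: "openin X U" and chart_on_subset: "U \<subseteq> topspace X"
    and chart_on_inj: "inj_on \<phi> U"
    and chart_on_image: "openin (top_of_set orthant) (\<phi> ` U)"
    and chart_on_continuous: "continuous_map (subtopology X U) (top_of_set (\<phi> ` U)) \<phi>"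
    and chart_on_inverse: "continuous_map (top_of_set (\<phi> ` U)) X (inv_into U \<phi>)"
    and chart_on_open_map: "open_map (subtopology X U) (top_of_set (\<phi> ` U)) \<phi>"
proof -
  have h: "homeomorphic_map (subtopology X U) (top_of_set (\<phi> ` U)) \<phi>"
    and U: "openin X U" and im: "openin (top_of_set orthant) (\<phi> ` U)"
    using assms by (auto simp: chart_on_def)
  show "openin X U" "openin (top_of_set orthant) (\<phi> ` U)" using U im by auto
  show sub: "U \<subseteq> topspace X" using U openin_subset by blast
  then have top: "topspace (subtopology X U) = U" by auto
  show inj: "inj_on \<phi> U" using homeomorphic_imp_injective_map[OF h] top by simp
  show "continuous_map (subtopology X U) (top_of_set (\<phi> ` U)) \<phi>"
    using homeomorphic_imp_continuous_map[OF h] .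
  show "open_map (subtopology X U) (top_of_set (\<phi> ` U)) \<phi>"
    using homeomorphic_imp_open_map[OF h] .
  obtain g where g: "homeomorphic_maps (subtopology X U) (top_of_set (\<phi> ` U)) \<phi> g"
    using h by (auto simp: homeomorphic_map_maps)
  have g\<phi>: "g (\<phi> x) = x" if "x \<in> U" for x
    using that g top unfolding homeomorphic_maps_def by blast
  have inv: "g y = inv_into U \<phi> y" if y: "y \<in> \<phi> ` U" for y
  proof -
    obtain x where x: "x \<in> U" "y = \<phi> x" using y by blast
    then show ?thesis using g\<phi> inj by simp
  qed
  have "continuous_map (top_of_set (\<phi> ` U)) (subtopology X U) g"
    using g unfolding homeomorphic_maps_def by blast
  then have "continuous_map (top_of_set (\<phi> ` U)) (subtopology X U) (inv_into U \<phi>)"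
    by (rule continuous_map_eq) (use inv in simp)
  then show "continuous_map (top_of_set (\<phi> ` U)) X (inv_into U \<phi>)"
    using continuous_map_into_fulltopology by blast
qed

lemma closed_orthant: "closed orthant"
  unfolding orthant_def by (intro closed_Collect_all closed_Collect_le continuous_intros)

text \<open>A slide in one chart extends to all of \<open>X\<close> by damping: the admitted drop is \<open>\<epsilon>\<close> near \<open>p\<close> and shrinks to
  zero before the boundary of the ball, where the slide therefore agrees with the identity. The Hausdorff
  property makes the compact support of the motion closed, so that both pieces live on open sets. The hypothesis \<open>reach\<close>
  abstracts from the reason why the level is met inside \<open>K\<close>.\<close>

lemma lowering_in_chart:
  fixes X :: "'a topology" and U :: "'a set" and \<phi> :: "'a \<Rightarrow> real ^ 'n::finite" and f :: "'a \<Rightarrow> real"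
  defines "F \<equiv> f \<circ> inv_into U \<phi>"
  assumes H: "Hausdorff_space X" and ch: "chart_on X (U, \<phi>)" and p: "p \<in> U"
    and f: "continuous_map X euclideanreal f" and fab: "f ` topspace X \<subseteq> {a..b}"
    and K: "compact K" "K \<subseteq> \<phi> ` U"
    and r: "0 < r" "ball (\<phi> p) r \<inter> orthant \<subseteq> K" and e: "0 < \<epsilon>" and s0: "0 \<le> s0"
    and dec: "decreasing_along v K F"
    and reach: "\<And>x u. x \<in> ball (\<phi> p) r \<inter> orthant \<Longrightarrow> u \<in> {a..b} \<Longrightarrow> F x - \<epsilon> \<le> u \<Longrightarrow> u \<le> F x \<Longrightarrow>
                  \<exists>s\<in>{0..s0}. x + s *\<^sub>R v \<in> K \<and> F (x + s *\<^sub>R v) = u"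
  shows "\<exists>G. lowering X a b f G \<and> exact_near X a b f G p"
proof -
  note ch' = chart_on_D[OF ch]
  let ?\<psi> = "inv_into U \<phi>" and ?P = "prod_topology X (top_of_set {a..b})"
  let ?slide = "slide K F v s0" and ?D = "slide_domain K F v s0"
  note slide = slide_in[OF dec, where ?s0.0=s0]
  have \<psi>\<phi>: "?\<psi> (\<phi> x) = x" if "x \<in> U" for x using ch'(3) that by simp
  have \<phi>\<psi>: "\<phi> (?\<psi> y) = y" "?\<psi> y \<in> U" if "y \<in> \<phi> ` U" for y
    using that by (simp_all add: f_inv_into_f inv_into_into)
  have F\<phi>: "F (\<phi> x) = f x" if "x \<in> U" for x using \<psi>\<phi>[OF that] by (simp add: F_def)
  have orth: "\<phi> x \<in> orthant" if "x \<in> U" for x using ch'(4) that openin_subset by fastforce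
  have range: "f x \<in> {a..b}" if "x \<in> topspace X" for x using fab that by blast
  \<comment> \<open>equal to 1 within distance \<open>r/3\<close> and to 0 beyond \<open>2r/3\<close>\<close>
  define bump where "bump = (\<lambda>y. max 0 (min 1 (2 - 3 * dist (\<phi> p) y / r)))"
  have bump01: "0 \<le> bump y" "bump y \<le> 1" for y by (auto simp: bump_def)
  have bump1: "bump y = 1" if "dist (\<phi> p) y \<le> r/3" for y
    using that r by (simp add: bump_def field_simps)
  have bump0: "bump y = 0" if "2 * r/3 \<le> dist (\<phi> p) y" for y
    using that r by (simp add: bump_def field_simps)
  have bumpc: "continuous_on UNIV bump" unfolding bump_def using r by (intro continuous_intros) auto
  \<comment> \<open>the damped target level; it never lies above the level of the point\<close>
  define level where "level = (\<lambda>z. min (f (fst z)) (max (snd z) (f (fst z) - \<epsilon> * bump (\<phi> (fst z)))))"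
  define U1 where "U1 = {x \<in> U. \<phi> x \<in> ball (\<phi> p) r}"
  define U2 where "U2 = topspace X - ?\<psi> ` (cball (\<phi> p) (2*r/3) \<inter> orthant)"
  define G where "G = (\<lambda>z. if fst z \<in> U1 then ?\<psi> (?slide (\<phi> (fst z), level z)) else fst z)"
  have U1U: "U1 \<subseteq> U" by (auto simp: U1_def)
  have U1X: "U1 \<subseteq> topspace X" using U1U ch'(2) by blast
  have chart_nbhd: "openin X {x \<in> U. \<phi> x \<in> B}" if "open B" for B
  proof -
    have c: "continuous_map (subtopology X U) euclidean \<phi>"
      using ch'(5) continuous_map_into_fulltopology by blast
    have "openin (subtopology X U) {x \<in> topspace (subtopology X U). \<phi> x \<in> B}"
      using that by (intro openin_continuous_map_preimage[OF c]) simp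
    moreover have "{x \<in> topspace (subtopology X U). \<phi> x \<in> B} = {x \<in> U. \<phi> x \<in> B}"
      using ch'(2) by auto
    ultimately show ?thesis using openin_trans_full[OF _ ch'(1)] by simp
  qed
  have U1o: "openin X U1" unfolding U1_def by (rule chart_nbhd) simp
  have capK: "cball (\<phi> p) (2*r/3) \<inter> orthant \<subseteq> K"
    using r by (intro order_trans[OF _ r(2)]) auto
  have "compact (cball (\<phi> p) (2*r/3) \<inter> orthant)"
    by (intro compact_Int_closed closed_orthant) simp
  then have "compactin (top_of_set (\<phi> ` U)) (cball (\<phi> p) (2*r/3) \<inter> orthant)"
    using capK K(2) by (simp add: compactin_subtopology)
  then have "compactin X (?\<psi> ` (cball (\<phi> p) (2*r/3) \<inter> orthant))"
    using ch'(6) by (rule image_compactin)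
  then have U2o: "openin X U2"
    unfolding U2_def using compactin_imp_closedin[OF H] by blast
  have cover: "topspace X \<subseteq> U1 \<union> U2"
  proof
    fix x assume x: "x \<in> topspace X"
    show "x \<in> U1 \<union> U2"
    proof (cases "x \<in> U2")
      case False
      then obtain y where y: "y \<in> cball (\<phi> p) (2*r/3) \<inter> orthant" "x = ?\<psi> y"
        using x by (auto simp: U2_def)
      have "y \<in> \<phi> ` U" using y(1) capK K(2) by blast
      then have "x \<in> U" "\<phi> x = y" using y \<phi>\<psi> by auto
      then show ?thesis using y(1) r(1) by (auto simp: U1_def)
    qed simp
  qed
  have far: "2*r/3 \<le> dist (\<phi> p) (\<phi> x)" if "x \<in> U2" "x \<in> U1" for x
  proof (rule ccontr)
    assume "\<not> 2*r/3 \<le> dist (\<phi> p) (\<phi> x)"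
    then have "\<phi> x \<in> cball (\<phi> p) (2*r/3) \<inter> orthant" using orth U1U that by auto
    then have "x \<in> ?\<psi> ` (cball (\<phi> p) (2*r/3) \<inter> orthant)"
      using \<psi>\<phi> U1U that(2) by (metis image_eqI subsetD)
    then show False using that by (simp add: U2_def)
  qed
  have lev: "level (x, u) \<in> {a..b}" "f x - \<epsilon> \<le> level (x, u)" "level (x, u) \<le> f x"
    if x: "x \<in> topspace X" and u: "u \<in> {a..b}" for x u
  proof -
    have "0 \<le> \<epsilon> * bump (\<phi> x)" "\<epsilon> * bump (\<phi> x) \<le> \<epsilon>"
      using bump01[of "\<phi> x"] e by (auto simp: mult_left_le)
    then show "level (x, u) \<in> {a..b}" "f x - \<epsilon> \<le> level (x, u)" "level (x, u) \<le> f x"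
      using range[OF x] u by (auto simp: level_def)
  qed
  have dom: "(\<phi> x, level (x, u)) \<in> ?D" if x: "x \<in> U1" and u: "u \<in> {a..b}" for x u
  proof -
    have "x \<in> topspace X" "x \<in> U" using x U1X U1U by auto
    then have "\<exists>s\<in>{0..s0}. \<phi> x + s *\<^sub>R v \<in> K \<and> F (\<phi> x + s *\<^sub>R v) = level (x, u)"
      using x lev[of x u] u orth by (intro reach) (auto simp: U1_def F\<phi>)
    then show ?thesis by (simp add: slide_domain_def)
  qed
  have stay: "?slide (\<phi> x, f x) = \<phi> x" if "x \<in> U1" for x
  proof (rule slide_eqI[OF dec])
    show "\<phi> x \<in> K" using that r(2) orth by (auto simp: U1_def)
    show "F (\<phi> x) = f x" using that U1U F\<phi> by blast
    show "\<phi> x - \<phi> x \<in> (\<lambda>s. s *\<^sub>R v) ` {0..s0}" using s0 by force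
  qed
  have G1: "f (G (x, u)) = level (x, u)" if x: "x \<in> U1" and u: "u \<in> {a..b}" for x u
    using slide(2)[OF dom[OF x u]] x by (simp add: G_def F_def)
  have Gstay: "G (x, u) = x" if "x \<in> U1" "level (x, u) = f x" for x u
    using stay that \<psi>\<phi> U1U by (auto simp: G_def)
  have G2: "G (x, u) = x" if "x \<in> U2" for x u
  proof (cases "x \<in> U1")
    case True
    then have "level (x, u) = f x" using bump0[OF far[OF that True]] by (simp add: level_def)
    then show ?thesis by (rule Gstay[OF True])
  qed (simp add: G_def)
  have contG: "continuous_map ?P X G"
  proof (rule pasting_lemma[where I="UNIV::bool set" and T="\<lambda>i. (if i then U1 else U2) \<times> {a..b}"
        and f="\<lambda>i. if i then (\<lambda>z. ?\<psi> (?slide (\<phi> (fst z), level z))) else fst"])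
    show "openin ?P ((if i then U1 else U2) \<times> {a..b})" for i
      using U1o U2o by (simp add: openin_prod_Times_iff)
    show "continuous_map (subtopology ?P ((if i then U1 else U2) \<times> {a..b})) X
          (if i then (\<lambda>z. ?\<psi> (?slide (\<phi> (fst z), level z))) else fst)" for i
    proof (cases i)
      case False
      then show ?thesis by (simp add: continuous_map_fst continuous_map_from_subtopology)
    next
      case True
      let ?Q = "subtopology ?P (U1 \<times> {a..b})"
      have topQ: "topspace ?Q = U1 \<times> {a..b}" using U1X by auto
      have c1: "continuous_map ?Q X fst"
        by (intro continuous_map_from_subtopology continuous_map_fst)
      have cU: "continuous_map ?Q (subtopology X U) fst"
        unfolding continuous_map_in_subtopology using U1U by (intro conjI c1) (auto simp: topQ)
      have c\<phi>: "continuous_map ?Q euclidean (\<lambda>z. \<phi> (fst z))"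
        using continuous_map_compose[OF cU ch'(5)] continuous_map_into_fulltopology
        by (fastforce simp: o_def)
      have cf: "continuous_map ?Q euclideanreal (\<lambda>z. f (fst z))"
        using continuous_map_compose[OF c1 f] by (simp add: o_def)
      have cs: "continuous_map ?Q euclideanreal snd"
        using continuous_map_snd continuous_map_into_fulltopology continuous_map_from_subtopology by blast
      have cb: "continuous_map ?Q euclideanreal (\<lambda>z. bump (\<phi> (fst z)))"
        using continuous_map_compose[OF c\<phi>, of euclideanreal bump] bumpc by (simp add: o_def)
      have cl: "continuous_map ?Q euclideanreal level"
        unfolding level_def
        by (intro continuous_map_real_min continuous_map_real_max continuous_map_diff
            continuous_map_real_mult cf cs cb) simp
      have "continuous_map ?Q (prod_topology euclidean euclideanreal) (\<lambda>z. (\<phi> (fst z), level z))"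
        by (intro continuous_map_pairedI c\<phi> cl)
      then have cD: "continuous_map ?Q (top_of_set ?D) (\<lambda>z. (\<phi> (fst z), level z))"
        unfolding continuous_map_in_subtopology euclidean_product_topology
        using dom by (auto simp: topQ)
      have "continuous_map (top_of_set ?D) (top_of_set (\<phi> ` U)) ?slide"
      proof (intro continuous_map_into_subtopology)
        have "F = f \<circ> ?\<psi>" by (simp add: F_def)
        then have "continuous_on K F"
          using continuous_map_compose[OF ch'(6) f] K(2) continuous_on_subset by fastforce
        then show "continuous_map (top_of_set ?D) euclidean ?slide"
          using continuous_on_slide[OF dec K(1)] by simp
        show "?slide \<in> topspace (top_of_set ?D) \<rightarrow> \<phi> ` U"
          using slide(1) K(2) by auto
      qed
      from continuous_map_compose[OF continuous_map_compose[OF cD this] ch'(6)] True show ?thesis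
        by (simp add: o_def)
    qed
    show "(if i then (\<lambda>z. ?\<psi> (?slide (\<phi> (fst z), level z))) else fst) z =
        (if j then (\<lambda>z. ?\<psi> (?slide (\<phi> (fst z), level z))) else fst) z"
      if "z \<in> topspace ?P \<inter> (if i then U1 else U2) \<times> {a..b} \<inter> (if j then U1 else U2) \<times> {a..b}" for i j z
      using that G2[of "fst z" "snd z"] by (cases i; cases j) (auto simp: G_def)
    show "\<exists>j. j \<in> UNIV \<and> z \<in> (if j then U1 else U2) \<times> {a..b} \<and>
        G z = (if j then (\<lambda>z. ?\<psi> (?slide (\<phi> (fst z), level z))) else fst) z"
      if "z \<in> topspace ?P" for z
    proof -
      have z: "fst z \<in> topspace X" "snd z \<in> {a..b}" using that by auto
      show ?thesis
      proof (cases "fst z \<in> U1")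
        case True
        then show ?thesis using z by (intro exI[of _ True]) (auto simp: G_def mem_Times_iff)
      next
        case False
        then have "fst z \<in> U2" using cover z(1) by blast
        then show ?thesis using False z by (intro exI[of _ False]) (auto simp: G_def mem_Times_iff)
      qed
    qed
  qed
  have low: "lowering X a b f G"
    unfolding lowering_def
  proof (intro conjI ballI impI contG)
    fix x u assume x: "x \<in> topspace X" and u: "u \<in> {a..b}"
    show "G (x, u) = x" if "f x \<le> u"
    proof (cases "x \<in> U1")
      case True
      then show ?thesis using that by (intro Gstay) (auto simp: level_def)
    qed (simp add: G_def)
    show "f (G (x, u)) \<in> {u..f x}" if "u \<le> f x"
    proof (cases "x \<in> U1")
      case True
      have "u \<le> level (x, u)" using that by (simp add: level_def)
      then show ?thesis using G1[OF True u] lev[OF x u] by simp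
    qed (use that in \<open>simp add: G_def\<close>)
  qed
  have "exact_near X a b f G p"
  proof (rule exact_nearI)
    show "openin X {x \<in> U. \<phi> x \<in> ball (\<phi> p) (r/3)}" by (rule chart_nbhd) simp
    show "p \<in> {x \<in> U. \<phi> x \<in> ball (\<phi> p) (r/3)}" using p r by simp
    show "0 < \<epsilon>" by (rule e)
    fix x u assume x: "x \<in> {x \<in> U. \<phi> x \<in> ball (\<phi> p) (r/3)}" and u: "u \<in> {a..b}" "f x - \<epsilon> \<le> u" "u \<le> f x"
    have "x \<in> U1" using x r by (auto simp: U1_def)
    moreover have "bump (\<phi> x) = 1" using x by (intro bump1) auto
    then have "level (x, u) = u" using u by (simp add: level_def)
    ultimately show "f (G (x, u)) = u" using G1 u(1) by simp
  qed
  with low show ?thesis by blast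
qed

section \<open>Derivatives on the orthant\<close>

lemma positive_coordinates_bound:
  fixes z :: "real ^ 'n::finite"
  shows "\<exists>\<rho>>0. \<forall>i. 0 < z $ i \<longrightarrow> \<rho> \<le> z $ i"
proof -
  define \<rho> where "\<rho> = Min (insert 1 ((\<lambda>i. z $ i) ` {i. 0 < z $ i}))"
  have "\<rho> > 0" by (auto simp: \<rho>_def)
  moreover have "\<rho> \<le> z $ i" if "0 < z $ i" for i
    unfolding \<rho>_def using that by (intro Min_le) auto
  ultimately show ?thesis by blast
qed

text \<open>Moving a little in a direction that is inward at \<open>z\<close> keeps \<^emph>\<open>all\<close> nearby points of the orthant inside it, not only
  \<open>z\<close>: coordinates that vanish at \<open>z\<close> do not decrease, and the others are far from zero.\<close>

lemma orthant_near:
  fixes z :: "real ^ 'n::finite"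
  assumes \<rho>: "\<forall>i. 0 < z $ i \<longrightarrow> \<rho> \<le> z $ i" and x: "x \<in> orthant" and s: "0 \<le> s"
    and v: "\<forall>i. z $ i = 0 \<longrightarrow> 0 \<le> v $ i" and z: "z \<in> orthant" and near: "dist z (x + s *\<^sub>R v) \<le> \<rho>"
  shows "x + s *\<^sub>R v \<in> orthant"
  unfolding orthant_def
proof (intro CollectI allI)
  fix i
  show "0 \<le> (x + s *\<^sub>R v) $ i"
  proof (cases "z $ i = 0")
    case True
    then show ?thesis using x s v by (simp add: orthant_def)
  next
    case False
    then have "\<rho> \<le> z $ i" using \<rho> z by (simp add: orthant_def less_le)
    moreover have "\<bar>(z - (x + s *\<^sub>R v)) $ i\<bar> \<le> \<rho>"
      using component_le_norm_cart[of "z - (x + s *\<^sub>R v)" i] near by (simp add: dist_norm)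
    ultimately show ?thesis by simp
  qed
qed

lemma relatively_open_ball:
  assumes "openin (top_of_set S) O1" "z \<in> O1"
  shows "\<exists>\<rho>>0. cball z \<rho> \<inter> S \<subseteq> O1"
  using assms openin_contains_cball by blast

text \<open>Near \<open>z\<close> the orthant is a polyhedral cone with apex \<open>z\<close>, hence each vector of its tangent cone is realised
  by a straight segment. One-sided derivatives along such segments replace derivatives along curves.\<close>

lemma inward_segment:
  fixes z v :: "real ^ 'n::finite"
  assumes O1: "openin (top_of_set orthant) O1" and z: "z \<in> O1"
    and v: "\<forall>i. z $ i = 0 \<longrightarrow> 0 \<le> v $ i"
  shows "\<exists>\<delta>>0. \<forall>t\<in>{0..\<delta>}. z + t *\<^sub>R v \<in> O1"
proof -
  obtain \<rho> where \<rho>: "\<rho> > 0" "cball z \<rho> \<inter> orthant \<subseteq> O1" using relatively_open_ball[OF O1 z] by blast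
  obtain \<mu> where \<mu>: "\<mu> > 0" "\<forall>i. 0 < z $ i \<longrightarrow> \<mu> \<le> z $ i" using positive_coordinates_bound by blast
  have zo: "z \<in> orthant" using O1 z openin_subset by fastforce
  define \<delta> where "\<delta> = min \<rho> \<mu> / (norm v + 1)"
  have "norm v + 1 > 0" by (simp add: add_nonneg_pos)
  then have "\<delta> > 0" using \<rho> \<mu> by (simp add: \<delta>_def)
  moreover have "z + t *\<^sub>R v \<in> O1" if t: "t \<in> {0..\<delta>}" for t
  proof -
    have "t * norm v \<le> \<delta> * (norm v + 1)" using t by (intro mult_mono) auto
    also have "\<dots> = min \<rho> \<mu>" using \<open>norm v + 1 > 0\<close> by (simp add: \<delta>_def)
    finally have d: "dist z (z + t *\<^sub>R v) \<le> min \<rho> \<mu>" using t by (simp add: dist_norm)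
    then have "z + t *\<^sub>R v \<in> orthant"
      using t by (intro orthant_near[OF \<mu>(2) zo _ v zo]) auto
    then show ?thesis using d \<rho>(2) by auto
  qed
  ultimately show ?thesis by blast
qed

text \<open>The basis vectors are inward at every point of the orthant.\<close>

lemma has_derivative_unique_orthant:
  fixes F :: "real ^ 'n::finite \<Rightarrow> 'b::real_normed_vector"
  assumes "openin (top_of_set orthant) O1" "z \<in> O1"
    and "(F has_derivative D) (at z within O1)" "(F has_derivative E) (at z within O1)"
  shows "D = E"
proof (rule frechet_derivative_unique_within[OF assms(3,4)])
  fix i :: "real ^ 'n" and e :: real assume i: "i \<in> Basis" and e: "e > 0"
  have "\<forall>j. z $ j = 0 \<longrightarrow> 0 \<le> i $ j"
    using i by (auto simp: Basis_vec_def axis_def)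
  from inward_segment[OF assms(1,2) this] obtain \<delta> where \<delta>: "\<delta> > 0" "\<forall>t\<in>{0..\<delta>}. z + t *\<^sub>R i \<in> O1"
    by blast
  then show "\<exists>d. 0 < \<bar>d\<bar> \<and> \<bar>d\<bar> < e \<and> z + d *\<^sub>R i \<in> O1"
    using e by (intro exI[of _ "min \<delta> (e/2)"]) auto
qed

text \<open>One-sided difference quotients along a segment.\<close>

lemma has_derivative_nonneg_along:
  fixes F :: "'e::real_normed_vector \<Rightarrow> real"
  assumes D: "(F has_derivative D) (at z within S)" and d: "\<delta> > 0"
    and seg: "\<And>t. t \<in> {0..\<delta>} \<Longrightarrow> z + t *\<^sub>R v \<in> S"
    and F: "\<And>t. t \<in> {0..\<delta>} \<Longrightarrow> F z \<le> F (z + t *\<^sub>R v)"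
  shows "0 \<le> D v"
proof -
  have line: "((\<lambda>t. z + t *\<^sub>R v) has_derivative (\<lambda>t. t *\<^sub>R v)) (at 0 within {0..\<delta>})"
    by (auto intro!: derivative_eq_intros)
  have img: "(\<lambda>t. z + t *\<^sub>R v) ` {0..\<delta>} \<subseteq> S" using seg by blast
  have "(F has_derivative D) (at (z + 0 *\<^sub>R v) within (\<lambda>t. z + t *\<^sub>R v) ` {0..\<delta>})"
    using has_derivative_subset[OF D img] by simp
  from has_derivative_in_compose[OF line this]
  have "((\<lambda>t. F (z + t *\<^sub>R v)) has_derivative (\<lambda>t. D (t *\<^sub>R v))) (at 0 within {0..\<delta>})"
    .
  moreover have "D (t *\<^sub>R v) = D v * t" for t
    using linear_scale[OF has_derivative_linear[OF D]] by simp
  ultimately have "((\<lambda>t. F (z + t *\<^sub>R v)) has_field_derivative D v) (at 0 within {0..\<delta>})"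
    by (simp add: has_field_derivative_def)
  then have lim: "((\<lambda>t. (F (z + t *\<^sub>R v) - F (z + 0 *\<^sub>R v)) / (t - 0)) \<longlongrightarrow> D v) (at 0 within {0..\<delta>})"
    by (simp add: has_field_derivative_iff)
  have "eventually (\<lambda>t. 0 \<le> (F (z + t *\<^sub>R v) - F (z + 0 *\<^sub>R v)) / (t - 0)) (at 0 within {0..\<delta>})"
    unfolding eventually_at_filter using F by (intro always_eventually) auto
  moreover have "at 0 within {0..\<delta>} \<noteq> bot"
    using d by (simp add: at_within_Icc_at_right)
  ultimately show ?thesis using tendsto_lowerbound[OF lim] by blast
qed

text \<open>Along the face the function is constant, which kills all partial derivatives but one; the remaining one is nonnegative
  by minimality and nonzero by surjectivity. Applied to the bottom fibre, and to the negated function on the top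
  fibre.\<close>

lemma face_minimum_derivative:
  fixes F :: "real ^ 'n::finite \<Rightarrow> real"
  assumes O1: "openin (top_of_set orthant) O1" and z: "z \<in> O1" "z $ i = 0"
    and D: "(F has_derivative D) (at z within O1)" "surj D"
    and min: "\<And>y. y \<in> O1 \<Longrightarrow> F z \<le> F y"
    and face: "\<And>y. y \<in> O1 \<Longrightarrow> y $ i = 0 \<Longrightarrow> F y = F z"
  shows "0 < D (axis i 1)"
proof -
  have lin: "linear D" using D(1) by (rule has_derivative_linear)
  have nonneg: "0 \<le> D (axis j 1)" for j
  proof -
    have "\<forall>k. z $ k = 0 \<longrightarrow> 0 \<le> (axis j 1 :: real^'n) $ k" by (simp add: axis_def)
    from inward_segment[OF O1 z(1) this] obtain \<delta> where \<delta>: "\<delta> > 0"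
      "\<forall>t\<in>{0..\<delta>}. z + t *\<^sub>R axis j 1 \<in> O1" by blast
    show ?thesis using \<delta>(2) min by (intro has_derivative_nonneg_along[OF D(1) \<delta>(1)]) auto
  qed
  have zero: "D (axis j 1) = 0" if "j \<noteq> i" for j
  proof -
    have "\<forall>k. z $ k = 0 \<longrightarrow> 0 \<le> (axis j 1 :: real^'n) $ k" by (simp add: axis_def)
    from inward_segment[OF O1 z(1) this] obtain \<delta> where \<delta>: "\<delta> > 0"
      "\<forall>t\<in>{0..\<delta>}. z + t *\<^sub>R axis j 1 \<in> O1" by blast
    have "F (z + t *\<^sub>R axis j 1) = F z" if "t \<in> {0..\<delta>}" for t
      using \<delta>(2) that z(2) \<open>j \<noteq> i\<close> by (intro face) (auto simp: axis_def)
    then have "0 \<le> - D (axis j 1)"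
      using \<delta>(2) by (intro has_derivative_nonneg_along[OF has_derivative_minus[OF D(1)] \<delta>(1)]) auto
    then show ?thesis using nonneg[of j] by simp
  qed
  have "D (axis i 1) \<noteq> 0"
  proof
    assume i0: "D (axis i 1) = 0"
    have "D x = 0" for x
    proof -
      have "D (axis j 1) = 0" for j using zero i0 by (cases "j = i") auto
      then have "D (\<Sum>j\<in>UNIV. x $ j *s axis j 1) = 0"
        by (simp add: linear_sum[OF lin] scalar_mult_eq_scaleR linear_scale[OF lin])
      then show ?thesis by (simp add: basis_expansion)
    qed
    then show False using D(2) by (metis surjD zero_neq_one)
  qed
  then show ?thesis using nonneg[of i] by simp
qed

section \<open>Lowering along steep directions\<close>

text \<open>A decrease at a definite rate, stated for segments instead of derivatives, so that it survives the passage from a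
  smooth extension to the function on the orthant.\<close>

definition steep_along :: "real \<Rightarrow> 'e::real_vector \<Rightarrow> 'e set \<Rightarrow> ('e \<Rightarrow> real) \<Rightarrow> bool" where
  "steep_along c v K F \<longleftrightarrow> (\<forall>x\<in>K. \<forall>s\<ge>0. x + s *\<^sub>R v \<in> K \<longrightarrow> F (x + s *\<^sub>R v) \<le> F x - c * s)"

lemma steep_alongD:
  "steep_along c v K F \<Longrightarrow> x \<in> K \<Longrightarrow> 0 \<le> s \<Longrightarrow> x + s *\<^sub>R v \<in> K \<Longrightarrow> F (x + s *\<^sub>R v) \<le> F x - c * s"
  by (simp add: steep_along_def)

text \<open>The directional derivative is continuous, hence bounded away from zero near \<open>z\<close>; integrate along the segment.\<close>

lemma steep_ball:
  fixes g :: "'e::euclidean_space \<Rightarrow> real"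
  assumes V: "open V" "z \<in> V" and g: "\<And>k. Ck_on k g V"
    and neg: "frechet_derivative g (at z) v < 0"
  shows "\<exists>R>0. \<exists>c>0. cball z R \<subseteq> V \<and> steep_along c v (cball z R) g"
proof -
  let ?h = "\<lambda>x. frechet_derivative g (at x) v"
  have diff: "g differentiable (at x)" if "x \<in> V" for x
    using g[of 1] that by simp
  have "continuous_on V ?h" using g[of 1] by simp
  then have "isCont ?h z" using V continuous_on_eq_continuous_at by blast
  define c where "c = - ?h z / 2"
  have c: "c > 0" using neg by (simp add: c_def)
  have "eventually (\<lambda>x. ?h x < - c) (at z)"
    using \<open>isCont ?h z\<close> neg unfolding isCont_def c_def by (intro order_tendstoD) auto
  then have "eventually (\<lambda>x. ?h x < - c) (nhds z)"
    unfolding eventually_at_filter using neg c by (auto elim!: eventually_mono simp: c_def)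
  then obtain S where S: "open S" "z \<in> S" "\<And>x. x \<in> S \<Longrightarrow> ?h x < - c"
    unfolding eventually_nhds by blast
  obtain R where R: "R > 0" "cball z R \<subseteq> S \<inter> V"
    using open_contains_cball[of "S \<inter> V"] S V by blast
  have "g (x + s *\<^sub>R v) \<le> g x - c * s"
    if x: "x \<in> cball z R" and s: "0 \<le> s" and xs: "x + s *\<^sub>R v \<in> cball z R" for x s
  proof -
    have "\<exists>y. ((\<lambda>t. g (x + t *\<^sub>R v) + c * t) has_real_derivative y) (at t) \<and> y \<le> 0"
      if t: "0 \<le> t" "t \<le> s" for t
    proof -
      have "x + t *\<^sub>R v \<in> cball z R"
      proof (cases "s = 0")
        case False
        have "x + t *\<^sub>R v = (1 - t/s) *\<^sub>R x + (t/s) *\<^sub>R (x + s *\<^sub>R v)"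
          using False by (simp add: algebra_simps)
        then show ?thesis
          using t False s x xs convexD[OF convex_cball[of z R] x xs, of "1 - t/s" "t/s"] by simp
      qed (use x t in simp)
      then have in': "x + t *\<^sub>R v \<in> S" "x + t *\<^sub>R v \<in> V" using R by auto
      let ?D = "frechet_derivative g (at (x + t *\<^sub>R v))"
      have D: "(g has_derivative ?D) (at (x + t *\<^sub>R v))"
        using diff[OF in'(2)] frechet_derivative_works by blast
      have "((\<lambda>t. g (x + t *\<^sub>R v)) has_derivative (\<lambda>h. ?D (h *\<^sub>R v))) (at t)"
      proof (rule has_derivative_compose[where f="\<lambda>t. x + t *\<^sub>R v" and g=g])
        show "((\<lambda>t. x + t *\<^sub>R v) has_derivative (\<lambda>h. h *\<^sub>R v)) (at t)"
          by (auto intro!: derivative_eq_intros)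
      qed (rule D)
      moreover have "?D (h *\<^sub>R v) = ?D v * h" for h
        using linear_scale[OF has_derivative_linear[OF D]] by simp
      ultimately have "((\<lambda>t. g (x + t *\<^sub>R v)) has_real_derivative ?D v) (at t)"
        by (simp add: has_field_derivative_def)
      then have "((\<lambda>t. g (x + t *\<^sub>R v) + c * t) has_real_derivative ?D v + c) (at t)"
        by (auto intro!: derivative_eq_intros)
      then show ?thesis using S(3)[OF in'(1)] by (intro exI[of _ "?D v + c"]) auto
    qed
    from DERIV_nonpos_imp_nonincreasing[OF s, of "\<lambda>t. g (x + t *\<^sub>R v) + c * t"] this
    show ?thesis by simp
  qed
  then have "steep_along c v (cball z R) g" by (simp add: steep_along_def)
  moreover have "cball z R \<subseteq> V" using R(2) by simp
  ultimately show ?thesis using R(1) c by (intro exI[of _ R] exI[of _ c] conjI)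
qed

text \<open>The function is known only on a relatively open part of the orthant; its derivative there agrees with that of a
  smooth extension by uniqueness, and the extension has a steep ball. The bound on \<open>R\<close> keeps the cap away from
  the faces that do not contain \<open>z\<close>.\<close>

lemma steep_cap:
  fixes F :: "real ^ 'n::finite \<Rightarrow> real"
  assumes O1: "openin (top_of_set orthant) O1" and z: "z \<in> O1"
    and F: "smooth_within O1 F" and D: "(F has_derivative D) (at z within O1)" and neg: "D v < 0"
  shows "\<exists>R c. 0 < R \<and> 0 < c \<and> cball z R \<inter> orthant \<subseteq> O1 \<and> (\<forall>i. 0 < z $ i \<longrightarrow> R \<le> z $ i) \<and>
    continuous_on (cball z R \<inter> orthant) F \<and> steep_along c v (cball z R \<inter> orthant) F"
proof -
  have "\<exists>V g. open V \<and> z \<in> V \<and> (\<forall>k. Ck_on k g V) \<and> (\<forall>y\<in>O1 \<inter> V. g y = F y)"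
    using F z unfolding smooth_within_def by (rule bspec)
  then obtain V g where V: "open V" "z \<in> V" and g': "\<forall>k. Ck_on k g V" and gF': "\<forall>y\<in>O1 \<inter> V. g y = F y"
    by (elim exE conjE)
  note g = spec[OF g'] and gF = bspec[OF gF']
  have "Ck_on (Suc 0) g V" "Ck_on 0 g V" by (rule g)+
  then have gd: "g differentiable (at z)" and gc: "continuous_on V g" using V by auto
  let ?g' = "frechet_derivative g (at z)"
  have O2: "openin (top_of_set orthant) (O1 \<inter> V)"
    using O1 V(1) by (simp add: openin_open_Int openin_Int_open)
  have "(g has_derivative ?g') (at z within O1 \<inter> V)"
    using gd frechet_derivative_works has_derivative_at_withinI by blast
  then have "(F has_derivative ?g') (at z within O1 \<inter> V)"
    by (rule has_derivative_transform[rotated 2]) (use z V gF in auto)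
  moreover have "(F has_derivative D) (at z within O1 \<inter> V)"
    using D by (rule has_derivative_subset) auto
  ultimately have "D = ?g'"
    using has_derivative_unique_orthant[OF O2] z V by blast
  then have "?g' v < 0" using neg by simp
  from steep_ball[OF V g this] obtain R1 c where R1: "R1 > 0" "c > 0" "cball z R1 \<subseteq> V" and
    st: "steep_along c v (cball z R1) g" by (elim exE conjE)
  obtain \<rho> where \<rho>: "\<rho> > 0" "cball z \<rho> \<inter> orthant \<subseteq> O1" using relatively_open_ball[OF O1 z] by blast
  obtain \<mu> where \<mu>: "\<mu> > 0" "\<forall>i. 0 < z $ i \<longrightarrow> \<mu> \<le> z $ i" using positive_coordinates_bound by blast
  define R where "R = min R1 (min \<rho> \<mu>)"
  have le: "R \<le> R1" "R \<le> \<rho>" "R \<le> \<mu>" by (auto simp: R_def)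
  have sub: "cball z R \<inter> orthant \<subseteq> O1 \<inter> V"
    using R1(3) \<rho>(2) subset_cball[OF le(1)] subset_cball[OF le(2)] by blast
  show ?thesis
  proof (rule exI[of _ R], rule exI[of _ c], intro conjI)
    show "0 < R" using R1 \<rho> \<mu> by (simp add: R_def)
    show "0 < c" by (rule R1)
    show "cball z R \<inter> orthant \<subseteq> O1" using sub by blast
    show "\<forall>i. 0 < z $ i \<longrightarrow> R \<le> z $ i" using \<mu>(2) le(3) by (meson order_trans)
    have "continuous_on (cball z R \<inter> orthant) g" using gc sub by (meson continuous_on_subset le_inf_iff)
    then show "continuous_on (cball z R \<inter> orthant) F"
      using gF sub by (subst continuous_on_cong[OF refl, of _ F g]) (simp_all add: subset_iff)
    show "steep_along c v (cball z R \<inter> orthant) F"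
      unfolding steep_along_def
    proof (intro ballI allI impI)
      fix x s assume x: "x \<in> cball z R \<inter> orthant" and s: "0 \<le> s" and xs: "x + s *\<^sub>R v \<in> cball z R \<inter> orthant"
      have "x \<in> cball z R1" "x + s *\<^sub>R v \<in> cball z R1" using x xs subset_cball[OF le(1)] by blast+
      then have "g (x + s *\<^sub>R v) \<le> g x - c * s" using s by (intro steep_alongD[OF st])
      moreover have "g x = F x" "g (x + s *\<^sub>R v) = F (x + s *\<^sub>R v)" by (intro gF subsetD[OF sub] x xs)+
      ultimately show "F (x + s *\<^sub>R v) \<le> F x - c * s" by simp
    qed
  qed
qed

lemma convex_orthant: "convex orthant"
  unfolding orthant_def convex_def by (auto intro!: add_nonneg_nonneg mult_nonneg_nonneg)

lemma segment_intermediate_value: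
  fixes F :: "'e::real_normed_vector \<Rightarrow> real"
  assumes K: "convex K" and F: "continuous_on K F" and x: "x \<in> K" "x + m *\<^sub>R v \<in> K" and m: "0 \<le> m"
    and u: "F (x + m *\<^sub>R v) \<le> u" "u \<le> F x"
  shows "\<exists>s\<in>{0..m}. x + s *\<^sub>R v \<in> K \<and> F (x + s *\<^sub>R v) = u"
proof -
  have seg: "x + s *\<^sub>R v \<in> K" if s: "s \<in> {0..m}" for s
  proof (cases "m = 0")
    case False
    have "x + s *\<^sub>R v = (1 - s/m) *\<^sub>R x + (s/m) *\<^sub>R (x + m *\<^sub>R v)"
      using False by (simp add: algebra_simps)
    then show ?thesis
      using s False m convexD[OF K x, of "1 - s/m" "s/m"] by simp
  qed (use x s in simp)
  have "continuous_on {0..m} (\<lambda>s. F (x + s *\<^sub>R v))"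
    using seg by (intro continuous_on_compose2[OF F] continuous_intros) auto
  from IVT2'[of "\<lambda>s. F (x + s *\<^sub>R v)" m u 0, OF _ _ m this] u
  obtain s where "0 \<le> s" "s \<le> m" "F (x + s *\<^sub>R v) = u" by auto
  then show ?thesis using seg by auto
qed

lemma decreasing_along_of_steep:
  assumes c: "0 < c" and st: "steep_along c v K F"
  shows "decreasing_along v K F"
  unfolding decreasing_along_def
proof (intro ballI allI impI)
  fix x s assume x: "x \<in> K" "0 < (s::real)" "x + s *\<^sub>R v \<in> K"
  have "F (x + s *\<^sub>R v) \<le> F x - c * s" using x by (intro steep_alongD[OF st]) simp_all
  moreover have "0 < c * s" using x c by simp
  ultimately show "F (x + s *\<^sub>R v) < F x" by linarith
qed

text \<open>The cap has radius \<open>R\<close>, while only points within \<open>R/2\<close> are moved, by at most \<open>R/2\<close>. Thus every slide stays in the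
  cap, and one of full length loses at least \<open>c * s0\<close> of height.\<close>

lemma lowering_along_inward_direction:
  fixes X :: "'a topology" and \<phi> :: "'a \<Rightarrow> real ^ 'n::finite" and f :: "'a \<Rightarrow> real"
  assumes H: "Hausdorff_space X" and ch: "chart_on X (U, \<phi>)" and p: "p \<in> U"
    and f: "continuous_map X euclideanreal f" and fab: "f ` topspace X \<subseteq> {a..b}"
    and sm: "smooth_within (\<phi> ` U) (f \<circ> inv_into U \<phi>)"
    and D: "differential_in (U, \<phi>) p f D"
    and v: "\<forall>i. \<phi> p $ i = 0 \<longrightarrow> 0 \<le> v $ i" and neg: "D v < 0"
  shows "\<exists>G. lowering X a b f G \<and> exact_near X a b f G p"
proof -
  have zO: "\<phi> p \<in> \<phi> ` U" using p by blast
  have D': "((f \<circ> inv_into U \<phi>) has_derivative D) (at (\<phi> p) within \<phi> ` U)"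
    using D by (simp add: differential_in_def)
  let ?F = "f \<circ> inv_into U \<phi>"
  obtain R c where R: "0 < R" "0 < c" and KO: "cball (\<phi> p) R \<inter> orthant \<subseteq> \<phi> ` U"
    and pos: "\<forall>i. 0 < \<phi> p $ i \<longrightarrow> R \<le> \<phi> p $ i"
    and Fc: "continuous_on (cball (\<phi> p) R \<inter> orthant) ?F"
    and st: "steep_along c v (cball (\<phi> p) R \<inter> orthant) ?F"
    using steep_cap[OF chart_on_image[OF ch] zO sm D' neg] by (elim exE conjE)
  let ?K = "cball (\<phi> p) R \<inter> orthant"
  have v0: "v \<noteq> 0" using neg linear_0[OF has_derivative_linear[OF D']] by auto
  define s0 where "s0 = R / (2 * norm v)"
  have s0: "s0 > 0" "s0 * norm v = R/2" using v0 R by (auto simp: s0_def)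
  have zorth: "\<phi> p \<in> orthant" using chart_on_image[OF ch] zO openin_subset by fastforce
  have Kc: "convex ?K" by (intro convex_Int convex_cball convex_orthant)
  show ?thesis
  proof (rule lowering_in_chart[OF H ch p f fab _ KO _ _ _ _ decreasing_along_of_steep[OF R(2) st]])
    show "compact ?K" by (intro compact_Int_closed closed_orthant) simp
    show "0 < R/2" "0 < c * s0" "0 \<le> s0" using R s0 by auto
    show "ball (\<phi> p) (R/2) \<inter> orthant \<subseteq> ?K" using R by auto
    fix x u assume x: "x \<in> ball (\<phi> p) (R/2) \<inter> orthant" and u: "u \<in> {a..b}"
      and le: "?F x - c * s0 \<le> u" "u \<le> ?F x"
    have xK: "x \<in> ?K" using x R by auto
    have "dist (\<phi> p) (x + s0 *\<^sub>R v) \<le> dist (\<phi> p) x + dist x (x + s0 *\<^sub>R v)" by (rule dist_triangle)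
    also have "\<dots> \<le> R" using x s0 by (simp add: dist_norm)
    finally have d: "dist (\<phi> p) (x + s0 *\<^sub>R v) \<le> R" .
    then have "x + s0 *\<^sub>R v \<in> orthant"
      using x s0 by (intro orthant_near[OF pos _ _ v zorth]) auto
    then have "x + s0 *\<^sub>R v \<in> ?K" using d by simp
    moreover from steep_alongD[OF st xK _ this] have "?F (x + s0 *\<^sub>R v) \<le> u" using s0 le by simp
    ultimately show "\<exists>s\<in>{0..s0}. x + s *\<^sub>R v \<in> ?K \<and> ?F (x + s *\<^sub>R v) = u"
      using s0 le by (intro segment_intermediate_value[OF Kc Fc xK]) auto
  qed
qed

text \<open>Here the descending direction points out of the orthant. The slide from \<open>x\<close> meets the face after \<open>x $ i\<close> units
  and is then at the lowest possible level, so every level in \<open>{a..b}\<close> below that of \<open>x\<close> is attained before.\<close>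

lemma lowering_onto_bottom_face:
  fixes X :: "'a topology" and \<phi> :: "'a \<Rightarrow> real ^ 'n::finite" and f :: "'a \<Rightarrow> real"
  assumes H: "Hausdorff_space X" and ch: "chart_on X (U, \<phi>)" and p: "p \<in> U"
    and f: "continuous_map X euclideanreal f" and fab: "f ` topspace X \<subseteq> {a..b}"
    and sm: "smooth_within (\<phi> ` U) (f \<circ> inv_into U \<phi>)"
    and D: "differential_in (U, \<phi>) p f D" "surj D"
    and fa: "f p = a" and face: "\<And>x. x \<in> U \<Longrightarrow> f x = a \<longleftrightarrow> \<phi> x $ i = 0"
  shows "\<exists>G. lowering X a b f G \<and> exact_near X a b f G p"
proof -
  let ?F = "f \<circ> inv_into U \<phi>" and ?v = "- axis i 1 :: real ^ 'n"
  have zO: "\<phi> p \<in> \<phi> ` U" using p by blast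
  have D': "(?F has_derivative D) (at (\<phi> p) within \<phi> ` U)"
    using D by (simp add: differential_in_def)
  have F\<phi>: "?F (\<phi> x) = f x" if "x \<in> U" for x using chart_on_inj[OF ch] that by simp
  have fge: "a \<le> f x" if "x \<in> U" for x using fab chart_on_subset[OF ch] that by fastforce
  have Fface: "?F y = a" if y: "y \<in> \<phi> ` U" "y $ i = 0" for y
  proof -
    obtain x where x: "x \<in> U" "y = \<phi> x" using y(1) by blast
    then have "f x = a" using face[OF x(1)] y(2) by simp
    then show ?thesis using F\<phi> x by simp
  qed
  have Fge: "a \<le> ?F y" if y: "y \<in> \<phi> ` U" for y
  proof -
    obtain x where x: "x \<in> U" "y = \<phi> x" using y by blast
    then show ?thesis using F\<phi> fge by simp
  qed
  have Fp: "?F (\<phi> p) = a" using F\<phi>[OF p] fa by simp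
  have "0 < D (axis i 1)"
  proof (rule face_minimum_derivative[OF chart_on_image[OF ch] zO _ D' D(2)])
    show "\<phi> p $ i = 0" using face[OF p] fa by simp
  qed (simp_all only: Fp Fge Fface)
  then have neg: "D ?v < 0" using linear_neg[OF has_derivative_linear[OF D']] by simp
  obtain R c where R: "0 < R" "0 < c" and KO: "cball (\<phi> p) R \<inter> orthant \<subseteq> \<phi> ` U"
    and Fc: "continuous_on (cball (\<phi> p) R \<inter> orthant) ?F"
    and st: "steep_along c ?v (cball (\<phi> p) R \<inter> orthant) ?F"
    using steep_cap[OF chart_on_image[OF ch] zO sm D' neg] by (elim exE conjE)
  let ?K = "cball (\<phi> p) R \<inter> orthant"
  have Kc: "convex ?K" by (intro convex_Int convex_cball convex_orthant)
  show ?thesis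
  proof (rule lowering_in_chart[OF H ch p f fab _ KO _ _ _ _ decreasing_along_of_steep[OF R(2) st]])
    show "compact ?K" by (intro compact_Int_closed closed_orthant) simp
    show "0 < R/2" "0 \<le> R/2" using R by auto
    show "(0::real) < 1" by simp
    show "ball (\<phi> p) (R/2) \<inter> orthant \<subseteq> ?K" using R by auto
    fix x u assume x: "x \<in> ball (\<phi> p) (R/2) \<inter> orthant" and u: "u \<in> {a..b}"
      and le: "?F x - 1 \<le> u" "u \<le> ?F x"
    have xK: "x \<in> ?K" using x R by auto
    have p0: "\<phi> p $ i = 0" using face p fa by blast
    have xi: "0 \<le> x $ i" using x by (simp add: orthant_def)
    have "\<bar>(x - \<phi> p) $ i\<bar> \<le> R/2"
      using component_le_norm_cart[of "x - \<phi> p" i] x by (simp add: dist_norm norm_minus_commute)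
    then have xiR: "x $ i \<le> R/2" using p0 by simp
    have "dist (\<phi> p) (x + (x $ i) *\<^sub>R ?v) \<le> dist (\<phi> p) x + dist x (x + (x $ i) *\<^sub>R ?v)" by (rule dist_triangle)
    also have "\<dots> \<le> R" using x xi xiR by (simp add: dist_norm)
    finally have "x + (x $ i) *\<^sub>R ?v \<in> cball (\<phi> p) R" by simp
    moreover have "x + (x $ i) *\<^sub>R ?v \<in> orthant" using x by (auto simp: orthant_def axis_def)
    ultimately have yK: "x + (x $ i) *\<^sub>R ?v \<in> ?K" by simp
    have "(x + (x $ i) *\<^sub>R ?v) $ i = 0" by (simp add: axis_def)
    then have "?F (x + (x $ i) *\<^sub>R ?v) \<le> u" using Fface yK KO u by fastforce
    then have "\<exists>s\<in>{0..x $ i}. x + s *\<^sub>R ?v \<in> ?K \<and> ?F (x + s *\<^sub>R ?v) = u"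
      using xi le by (intro segment_intermediate_value[OF Kc Fc xK yK]) auto
    then show "\<exists>s\<in>{0..R/2}. x + s *\<^sub>R ?v \<in> ?K \<and> ?F (x + s *\<^sub>R ?v) = u" using xiR by fastforce
  qed
qed

section \<open>Outward ascending directions\<close>

lemma chart_on_image_Int:
  assumes "chart_on X (U, \<phi>)" "openin X V"
  shows "openin (top_of_set orthant) (\<phi> ` (U \<inter> V))"
proof -
  have "openin (subtopology X U) (U \<inter> V)"
    using assms(2) by (metis inf_commute openin_subtopology_Int2)
  then have "openin (top_of_set (\<phi> ` U)) (\<phi> ` (U \<inter> V))"
    using chart_on_open_map[OF assms(1)] by (simp add: open_map_def)
  then show ?thesis using chart_on_image[OF assms(1)] openin_trans by blast
qed

text \<open>The derivative of any local smooth extension restricts.\<close>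

lemma smooth_within_has_derivative:
  assumes "smooth_within S f" "x \<in> S"
  shows "\<exists>D. (f has_derivative D) (at x within S)"
proof -
  obtain V g where V: "open V" "x \<in> V" and g: "\<forall>k. Ck_on k g V" and gf: "\<forall>y\<in>S \<inter> V. g y = f y"
    using bspec[OF assms(1)[unfolded smooth_within_def] assms(2)] by (elim exE conjE)
  have "Ck_on (Suc 0) g V" using g by (rule spec)
  then have "g differentiable (at x)" using V by simp
  then have "(g has_derivative frechet_derivative g (at x)) (at x within S)"
    using frechet_derivative_works has_derivative_at_withinI by blast
  moreover have "eventually (\<lambda>y. y \<in> V) (at x within S)"
    using V by (simp add: eventually_at_topological) blast
  then have "eventually (\<lambda>y. g y = f y) (at x within S)"
    using gf by (auto simp: eventually_at_filter elim: eventually_mono)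
  moreover have "g x = f x" using gf assms(2) V by simp
  ultimately have "(f has_derivative frechet_derivative g (at x)) (at x within S)"
    using has_derivative_transform_eventually assms(2) by blast
  then show ?thesis by blast
qed

text \<open>A transition map takes values in the orthant, so a coordinate that vanishes at \<open>p\<close> cannot decrease in an inward
  direction.\<close>

lemma transition_preserves_inward:
  fixes \<phi> \<psi> :: "'a \<Rightarrow> real ^ 'n::finite"
  assumes U: "chart_on X (U, \<phi>)" and V: "chart_on X (V, \<psi>)" and p: "p \<in> U" "p \<in> V"
    and T: "((\<psi> \<circ> inv_into U \<phi>) has_derivative T) (at (\<phi> p) within \<phi> ` (U \<inter> V))"
    and v: "\<forall>i. \<phi> p $ i = 0 \<longrightarrow> 0 \<le> v $ i" and j: "\<psi> p $ j = 0"
  shows "0 \<le> T v $ j"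
proof -
  have O1: "openin (top_of_set orthant) (\<phi> ` (U \<inter> V))"
    by (rule chart_on_image_Int[OF U chart_on_open[OF V]])
  obtain \<delta> where \<delta>: "\<delta> > 0" "\<forall>t\<in>{0..\<delta>}. \<phi> p + t *\<^sub>R v \<in> \<phi> ` (U \<inter> V)"
    using inward_segment[OF O1 _ v] p by blast
  let ?h = "\<lambda>y. (\<psi> \<circ> inv_into U \<phi>) y $ j"
  have "(?h has_derivative (\<lambda>y. T y $ j)) (at (\<phi> p) within \<phi> ` (U \<inter> V))"
    using bounded_linear.has_derivative[OF bounded_linear_vec_nth T] .
  then show ?thesis
  proof (rule has_derivative_nonneg_along[OF _ \<delta>(1)])
    fix t assume t: "t \<in> {0..\<delta>}"
    then obtain x where x: "x \<in> U" "x \<in> V" "\<phi> p + t *\<^sub>R v = \<phi> x" using \<delta>(2) by blast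
    show "\<phi> p + t *\<^sub>R v \<in> \<phi> ` (U \<inter> V)" using \<delta>(2) t by blast
    have "\<psi> x \<in> orthant" using chart_on_image[OF V] x(2) openin_subset by fastforce
    then have "0 \<le> \<psi> x $ j" by (simp add: orthant_def)
    then show "?h (\<phi> p) \<le> ?h (\<phi> p + t *\<^sub>R v)"
      using chart_on_inj[OF U] p x j by simp
  qed
qed

text \<open>Being outward is the negation of being inward, and transition maps preserve inwardness in both directions with
  mutually inverse derivatives. So an outward vector stays outward, even though the vanishing coordinates in
  the two charts have no relation to each other.\<close>

lemma outward_ascent_transition:
  fixes \<phi> \<psi> :: "'a \<Rightarrow> real ^ 'n::finite"
  assumes U: "chart_on X (U, \<phi>)" and V: "chart_on X (V, \<psi>)" and p: "p \<in> U" "p \<in> V"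
    and tr: "smooth_transition (U, \<phi>) (V, \<psi>)" "smooth_transition (V, \<psi>) (U, \<phi>)"
    and D: "differential_in (U, \<phi>) p f D" and E: "differential_in (V, \<psi>) p f E"
    and out: "\<phi> p $ i = 0" "\<eta> $ i < 0" and asc: "D \<eta> > 0"
  shows "\<exists>j \<theta>. \<psi> p $ j = 0 \<and> \<theta> $ j < 0 \<and> E \<theta> > 0"
proof -
  let ?h = "\<psi> \<circ> inv_into U \<phi>" and ?k = "\<phi> \<circ> inv_into V \<psi>"
  let ?O = "\<phi> ` (U \<inter> V)" and ?Q = "\<psi> ` (V \<inter> U)"
  have O1: "openin (top_of_set orthant) ?O" and zO: "\<phi> p \<in> ?O"
    using chart_on_image_Int[OF U chart_on_open[OF V]] p by auto
  have hp: "?h (\<phi> x) = \<psi> x" if "x \<in> U" for x using chart_on_inj[OF U] that by simp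
  have kp: "?k (\<psi> x) = \<phi> x" if "x \<in> V" for x using chart_on_inj[OF V] that by simp
  have hO: "?h ` ?O = ?Q" using hp by (auto simp: image_iff simp del: o_apply)
  obtain T where T: "(?h has_derivative T) (at (\<phi> p) within ?O)"
    using smooth_within_has_derivative[of ?O ?h] tr(1) zO by (auto simp: smooth_transition_def)
  obtain S where S: "(?k has_derivative S) (at (\<psi> p) within ?Q)"
    using smooth_within_has_derivative[of ?Q ?k "\<psi> p"] tr(2) p by (auto simp: smooth_transition_def)
  have "(?k has_derivative S) (at (?h (\<phi> p)) within ?h ` ?O)"
    using S unfolding hO hp[OF p(1)] .
  from has_derivative_in_compose[OF T this]
  have kh: "((\<lambda>y. ?k (?h y)) has_derivative (\<lambda>y. S (T y))) (at (\<phi> p) within ?O)" .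
  have "((\<lambda>y. y) has_derivative (\<lambda>y. S (T y))) (at (\<phi> p) within ?O)"
  proof (rule has_derivative_transform[OF zO _ kh])
    fix y assume "y \<in> ?O"
    then obtain x where "x \<in> U" "x \<in> V" "y = \<phi> x" by blast
    then show "y = ?k (?h y)" using hp kp by (simp del: o_apply)
  qed
  then have ST: "(\<lambda>y. S (T y)) = (\<lambda>y. y)"
    using has_derivative_unique_orthant[OF O1 zO] has_derivative_ident by blast
  have "((f \<circ> inv_into V \<psi>) has_derivative E) (at (?h (\<phi> p)) within ?h ` ?O)"
    unfolding hO hp[OF p(1)]
    using E by (auto simp: differential_in_def intro: has_derivative_subset)
  from has_derivative_in_compose[OF T this]
  have fh: "((\<lambda>y. (f \<circ> inv_into V \<psi>) (?h y)) has_derivative (\<lambda>y. E (T y))) (at (\<phi> p) within ?O)" .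
  have "((f \<circ> inv_into U \<phi>) has_derivative (\<lambda>y. E (T y))) (at (\<phi> p) within ?O)"
  proof (rule has_derivative_transform[OF zO _ fh])
    fix y assume "y \<in> ?O"
    then obtain x where "x \<in> U" "x \<in> V" "y = \<phi> x" by blast
    then show "(f \<circ> inv_into U \<phi>) y = (f \<circ> inv_into V \<psi>) (?h y)"
      using chart_on_inj[OF U] chart_on_inj[OF V] by simp
  qed
  moreover have "((f \<circ> inv_into U \<phi>) has_derivative D) (at (\<phi> p) within ?O)"
    using D by (auto simp: differential_in_def intro: has_derivative_subset)
  ultimately have ET: "(\<lambda>y. E (T y)) = D"
    by (rule has_derivative_unique_orthant[OF O1 zO])
  have "\<exists>j. \<psi> p $ j = 0 \<and> T \<eta> $ j < 0"
  proof (rule ccontr)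
    assume "\<nexists>j. \<psi> p $ j = 0 \<and> T \<eta> $ j < 0"
    then have inw: "\<forall>j. \<psi> p $ j = 0 \<longrightarrow> 0 \<le> T \<eta> $ j" by (metis not_le)
    have "0 \<le> S (T \<eta>) $ i"
      by (rule transition_preserves_inward[OF V U p(2,1) S inw out(1)])
    then show False using fun_cong[OF ST, of \<eta>] out(2) by simp
  qed
  then show ?thesis using asc fun_cong[OF ET, of \<eta>] by metis
qed

section \<open>Tame functions with a unique critical point of type D\<close>

lemma smooth_charts_chart_on: "c \<in> smooth_charts X A \<Longrightarrow> chart_on X c"
  by (simp add: smooth_charts_def)

lemma atlas_subset_smooth_charts: "smooth_atlas X A \<Longrightarrow> A \<subseteq> smooth_charts X A"
  by (auto simp: smooth_atlas_def smooth_charts_def)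

lemma atlas_chart_at:
  assumes "smooth_atlas X A" "p \<in> topspace X"
  obtains U \<phi> where "(U, \<phi>) \<in> A" "(U, \<phi>) \<in> smooth_charts X A" "p \<in> U"
proof -
  obtain c where "c \<in> A" "p \<in> fst c" using assms by (auto simp: smooth_atlas_def)
  then show thesis using that[of "fst c" "snd c"] atlas_subset_smooth_charts[OF assms(1)] by auto
qed

lemma smooth_functionD:
  "smooth_function X A f \<Longrightarrow> (U, \<phi>) \<in> smooth_charts X A \<Longrightarrow> smooth_within (\<phi> ` U) (f \<circ> inv_into U \<phi>)"
  by (auto simp: smooth_function_def)

lemma submersiveD:
  "submersive X A f \<Longrightarrow> (U, \<phi>) \<in> smooth_charts X A \<Longrightarrow> p \<in> U \<Longrightarrow> \<exists>D. differential_in (U, \<phi>) p f D \<and> surj D"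
  by (auto simp: submersive_def)

lemma smooth_function_continuous:
  assumes A: "smooth_atlas X A" and f: "smooth_function X A f"
  shows "continuous_map X euclideanreal f"
proof (rule pasting_lemma[where I=A and T=fst and f="\<lambda>c. f"])
  fix c assume c: "c \<in> A"
  obtain U \<phi> where c_eq: "c = (U, \<phi>)" by (cases c)
  have cs: "(U, \<phi>) \<in> smooth_charts X A" using atlas_subset_smooth_charts[OF A] c c_eq by blast
  note ch = smooth_charts_chart_on[OF cs]
  show "openin X (fst c)" using chart_on_open[OF ch] by (simp add: c_eq)
  have "continuous_on (\<phi> ` U) (f \<circ> inv_into U \<phi>)"
    unfolding continuous_on_eq_continuous_within
    using smooth_within_has_derivative[OF smooth_functionD[OF f cs]] has_derivative_continuous by blast
  then have "continuous_map (top_of_set (\<phi> ` U)) euclideanreal (f \<circ> inv_into U \<phi>)" by simp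
  from continuous_map_compose[OF chart_on_continuous[OF ch] this]
  have "continuous_map (subtopology X U) euclideanreal ((f \<circ> inv_into U \<phi>) \<circ> \<phi>)" .
  then have "continuous_map (subtopology X U) euclideanreal f"
    by (rule continuous_map_eq) (use chart_on_inj[OF ch] in simp)
  then show "continuous_map (subtopology X (fst c)) euclideanreal f" by (simp add: c_eq)
next
  fix x assume "x \<in> topspace X"
  then have "x \<in> (\<Union>c\<in>A. fst c)" using A unfolding smooth_atlas_def by blast
  then show "\<exists>j. j \<in> A \<and> x \<in> fst j \<and> f x = f x" by blast
qed simp

lemma hypersurface_boundary_subset: "hypersurface_boundary X A Y \<subseteq> Y"
  by (auto simp: hypersurface_boundary_def)

text \<open>Two charts of the maximal atlas are both compatible with the given atlas, whereas the definition says nothing about the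
  transition between them. The vector is therefore carried through a chart of the atlas.\<close>

lemma type_D_outward_ascent:
  assumes A: "smooth_atlas X A" and sub: "submersive X A f"
    and D: "critical_point_type_D X A B f q"
    and c: "(U, \<phi>) \<in> smooth_charts X A" "q \<in> U" "differential_in (U, \<phi>) q f E"
  shows "\<exists>j \<theta>. \<phi> q $ j = 0 \<and> \<theta> $ j < 0 \<and> E \<theta> > 0"
proof -
  obtain U1 \<phi>1 i D1 \<eta> where 1: "(U1, \<phi>1) \<in> smooth_charts X A" "q \<in> U1"
      "differential_in (U1, \<phi>1) q f D1" "\<phi>1 q $ i = 0" "\<eta> $ i < 0" "D1 \<eta> > 0"
    using D unfolding critical_point_type_D_def by (elim conjE exE)
  have "q \<in> topspace X" using chart_on_subset[OF smooth_charts_chart_on[OF c(1)]] c(2) by blast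
  then obtain U2 \<phi>2 where 2: "(U2, \<phi>2) \<in> A" "(U2, \<phi>2) \<in> smooth_charts X A" "q \<in> U2"
    by (rule atlas_chart_at[OF A])
  obtain D2 where D2: "differential_in (U2, \<phi>2) q f D2" using submersiveD[OF sub 2(2,3)] by blast
  have tr: "smooth_transition (U1, \<phi>1) (U2, \<phi>2)" "smooth_transition (U2, \<phi>2) (U1, \<phi>1)"
    "smooth_transition (U2, \<phi>2) (U, \<phi>)" "smooth_transition (U, \<phi>) (U2, \<phi>2)"
    using 1(1) c(1) 2(1) by (auto simp: smooth_charts_def)
  note ch = smooth_charts_chart_on[OF 1(1)] smooth_charts_chart_on[OF 2(2)] smooth_charts_chart_on[OF c(1)]
  obtain k \<zeta> where "\<phi>2 q $ k = 0" "\<zeta> $ k < 0" "D2 \<zeta> > 0"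
    using outward_ascent_transition[OF ch(1,2) 1(2) 2(3) tr(1,2) 1(3) D2 1(4-6)] by blast
  from outward_ascent_transition[OF ch(2,3) 2(3) c(2) tr(3,4) D2 c(3) this] show ?thesis .
qed

text \<open>Here the geometry of a tame function enters. Its corners lie over \<open>a\<close> or \<open>b\<close>, where the direction used is
  transversal to the face that is the fibre and parallel to all others. Strictly between \<open>a\<close> and \<open>b\<close>, a point
  of \<open>B\<close> has exactly one vanishing coordinate in a suitable adapted chart, so a vector or its negative is inward.\<close>

lemma tame_local_lowering:
  fixes X :: "'a topology" and A :: "('a, 'n::finite) chart set"
  assumes cob: "compact_cobordism X A Xm B Xp" and tame: "tame X A Xm B Xp a b \<pi>"
    and q: "critical_points_on X A B \<pi> = {q}" and D: "critical_point_type_D X A B \<pi> q"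
    and p: "p \<in> topspace X"
  shows "\<exists>G. lowering X a b \<pi> G \<and> exact_near X a b \<pi> G p"
proof -
  have A: "smooth_atlas X A" and H: "Hausdorff_space X"
    using cob unfolding compact_cobordism_def manifold_with_corners_def by blast+
  have sm: "smooth_function X A \<pi>" and sub: "submersive X A \<pi>" and ran: "\<pi> ` topspace X \<subseteq> {a..b}"
    and Xm: "Xm = {p \<in> topspace X. \<pi> p = a}" and Xp: "Xp = {p \<in> topspace X. \<pi> p = b}"
    using tame by (auto simp: tame_def)
  have hyp: "hypersurface_with_boundary X A Xm" "hypersurface_with_boundary X A Xp"
    "hypersurface_with_boundary X A B" and bd: "mfd_boundary X A = Xm \<union> B \<union> Xp"
    and hbd: "hypersurface_boundary X A B = hypersurface_boundary X A Xm \<union> hypersurface_boundary X A Xp"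
    using cob unfolding compact_cobordism_def by blast+
  note cont = smooth_function_continuous[OF A sm]
  have inward: ?thesis if c: "(U, \<phi>) \<in> smooth_charts X A" "p \<in> U" and d: "differential_in (U, \<phi>) p \<pi> E"
      and v: "\<forall>i. \<phi> p $ i = 0 \<longrightarrow> 0 \<le> v $ i" "E v < 0" for U and \<phi> :: "'a \<Rightarrow> real ^ 'n" and E v
    by (rule lowering_along_inward_direction[OF H smooth_charts_chart_on[OF c(1)] c(2) cont ran
          smooth_functionD[OF sm c(1)] d v])
  have lin: "linear E" if "differential_in (U, \<phi>) p \<pi> E" for U and \<phi> :: "'a \<Rightarrow> real ^ 'n" and E
    using that has_derivative_linear by (auto simp: differential_in_def)
  consider "p \<in> Xm" | "p \<in> Xp" | "p \<in> B" "p \<notin> Xm" "p \<notin> Xp" | "p \<notin> mfd_boundary X A" using bd by blast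
  then show ?thesis
  proof cases
    case 1
    then obtain U \<phi> i where c: "adapted_chart X A Xm (U, \<phi>) i" "p \<in> U"
      using hyp(1) unfolding hypersurface_with_boundary_def by blast
    then have cs: "(U, \<phi>) \<in> smooth_charts X A" and face: "Xm \<inter> U = {x \<in> U. \<phi> x $ i = 0}"
      by (auto simp: adapted_chart_def)
    obtain E where E: "differential_in (U, \<phi>) p \<pi> E" "surj E" using submersiveD[OF sub cs c(2)] by blast
    show ?thesis
    proof (rule lowering_onto_bottom_face[OF H smooth_charts_chart_on[OF cs] c(2) cont ran
          smooth_functionD[OF sm cs] E])
      show "\<pi> p = a" using 1 Xm by simp
      show "\<pi> x = a \<longleftrightarrow> \<phi> x $ i = 0" if "x \<in> U" for x
        using face that Xm chart_on_subset[OF smooth_charts_chart_on[OF cs]] by blast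
    qed
  next
    case 2
    then obtain U \<phi> i where c: "adapted_chart X A Xp (U, \<phi>) i" "p \<in> U"
      using hyp(2) unfolding hypersurface_with_boundary_def by blast
    then have cs: "(U, \<phi>) \<in> smooth_charts X A" and face: "Xp \<inter> U = {x \<in> U. \<phi> x $ i = 0}"
      by (auto simp: adapted_chart_def)
    note ch = smooth_charts_chart_on[OF cs]
    obtain E where E: "differential_in (U, \<phi>) p \<pi> E" "surj E" using submersiveD[OF sub cs c(2)] by blast
    let ?F = "\<lambda>y. - (\<pi> \<circ> inv_into U \<phi>) y"
    have F: "?F (\<phi> x) = - \<pi> x" if "x \<in> U" for x using chart_on_inj[OF ch] that by simp
    have le: "\<pi> x \<le> b" if "x \<in> U" for x using ran chart_on_subset[OF ch] that by fastforce
    have pb: "\<pi> p = b" using 2 Xp by simp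
    have "0 < - E (axis i 1)"
    proof (rule face_minimum_derivative[OF chart_on_image[OF ch], where F="?F"])
      show "\<phi> p \<in> \<phi> ` U" using c(2) by blast
      show "\<phi> p $ i = 0" using face 2 c(2) by blast
      show "(?F has_derivative (\<lambda>x. - E x)) (at (\<phi> p) within \<phi> ` U)"
        using has_derivative_minus[of "\<pi> \<circ> inv_into U \<phi>" E] E(1) by (simp add: differential_in_def)
      show "surj (\<lambda>x. - E x)"
        using E(2) unfolding surj_def by (metis minus_minus)
      fix y assume "y \<in> \<phi> ` U"
      then obtain x where x: "x \<in> U" "y = \<phi> x" by blast
      show "?F (\<phi> p) \<le> ?F y" unfolding x(2) F[OF x(1)] F[OF c(2)] using le[OF x(1)] pb by simp
      assume "y $ i = 0"
      then have "x \<in> Xp" using face x by blast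
      then have "\<pi> x = b" using Xp by simp
      then show "?F y = ?F (\<phi> p)" unfolding x(2) F[OF x(1)] F[OF c(2)] using pb by simp
    qed
    then show ?thesis by (intro inward[OF cs c(2) E(1), of "axis i 1"]) (simp_all add: axis_def)
  next
    case 3
    have "p \<notin> hypersurface_boundary X A B"
      unfolding hbd using 3(2,3) hypersurface_boundary_subset[of X A Xm] hypersurface_boundary_subset[of X A Xp]
      by blast
    moreover obtain U \<phi> i where c: "adapted_chart X A B (U, \<phi>) i" "p \<in> U" "card {j. j \<noteq> i \<and> \<phi> p $ j = 0} \<le> 1"
      using bspec[OF conjunct2[OF hyp(3)[unfolded hypersurface_with_boundary_def]] 3(1)] by (elim exE conjE)
    ultimately have "card {j. j \<noteq> i \<and> \<phi> p $ j = 0} \<noteq> 1"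
      using 3(1) unfolding hypersurface_boundary_def by blast
    with c(3) have "card {j. j \<noteq> i \<and> \<phi> p $ j = 0} = 0" by linarith
    then have only: "j = i" if "\<phi> p $ j = 0" for j using that by auto
    have cs: "(U, \<phi>) \<in> smooth_charts X A" using c by (simp add: adapted_chart_def)
    obtain E where E: "differential_in (U, \<phi>) p \<pi> E" using submersiveD[OF sub cs c(2)] by blast
    show ?thesis
    proof (cases "\<exists>v. v $ i = 0 \<and> E v \<noteq> 0")
      case True
      then obtain v where v: "v $ i = 0" "E v \<noteq> 0" by blast
      show ?thesis
      proof (cases "E v < 0")
        case True
        then show ?thesis using v only by (intro inward[OF cs c(2) E, of v]) auto
      next
        case False
        then have "E (- v) < 0" using v linear_neg[OF lin[OF E]] by simp
        then show ?thesis using v only by (intro inward[OF cs c(2) E, of "- v"]) auto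
      qed
    next
      case False
      \<comment> \<open>the differential is a multiple of the only vanishing coordinate, so the sign of this multiple decides\<close>
      then have "p \<in> critical_points_on X A B \<pi>"
        using 3(1) c E unfolding critical_points_on_def by blast
      then have "p = q" using q by simp
      then obtain j \<theta> where \<theta>: "\<phi> p $ j = 0" "\<theta> $ j < 0" "E \<theta> > 0"
        using type_D_outward_ascent[OF A sub D cs] c(2) E by blast
      have "E (- \<theta>) < 0" using \<theta>(3) linear_neg[OF lin[OF E]] by simp
      moreover have "\<forall>k. \<phi> p $ k = 0 \<longrightarrow> 0 \<le> (- \<theta>) $ k"
        using only only[OF \<theta>(1)] \<theta>(2) by auto
      ultimately show ?thesis by (intro inward[OF cs c(2) E])
    qed
  next
    case 4
    obtain U \<phi> where c: "(U, \<phi>) \<in> smooth_charts X A" "p \<in> U" using atlas_chart_at[OF A p] by metis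
    then have "\<phi> p $ i \<noteq> 0" for i using 4 p unfolding mfd_boundary_def by blast
    moreover obtain E where E: "differential_in (U, \<phi>) p \<pi> E" "surj E" using submersiveD[OF sub c] by blast
    moreover obtain v where "E v = - 1" using E(2) by (metis surjD)
    ultimately show ?thesis by (intro inward[OF c E(1), of v]) auto
  qed
qed

theorem proposition3p6:
  fixes X :: "'a topology" and A :: "('a, 'n::finite) chart set"
    and Xm B Xp :: "'a set" and a b :: real and \<pi> :: "'a \<Rightarrow> real"
  assumes "a < b"
    and "compact_cobordism X A Xm B Xp"
    and "tame X A Xm B Xp a b \<pi>"
    and "\<exists>q. critical_points_on X A B \<pi> = {q} \<and> critical_point_type_D X A B \<pi> q"
  shows "zero_sectional X a b \<pi> \<and>
    (\<forall>\<gamma>. triple_path X a b \<pi> \<gamma> \<longrightarrow>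
      (\<exists>\<sigma>. section_of X a b \<pi> \<sigma> \<and>
        homotopic_with (triple_path X a b \<pi>) (top_of_set {a..b}) X \<gamma> \<sigma> \<and>
        (\<forall>\<tau>. section_of X a b \<pi> \<tau> \<and>
              homotopic_with (triple_path X a b \<pi>) (top_of_set {a..b}) X \<gamma> \<tau> \<longrightarrow>
            homotopic_with (section_of X a b \<pi>) (top_of_set {a..b}) X \<sigma> \<tau>)))"
proof -
  obtain q where q: "critical_points_on X A B \<pi> = {q}" "critical_point_type_D X A B \<pi> q"
    using assms(4) by blast
  have comp: "compact_space X" and atlas: "smooth_atlas X A"
    using assms(2) unfolding compact_cobordism_def manifold_with_corners_def by blast+
  have sm: "smooth_function X A \<pi>" and ran: "\<pi> ` topspace X \<subseteq> {a..b}"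
    using assms(3) by (auto simp: tame_def)
  obtain \<Psi> where \<Psi>: "descent X a b \<pi> \<Psi>"
    using descent_from_local_lowerings[OF comp smooth_function_continuous[OF atlas sm] less_imp_le[OF assms(1)] ran
        tame_local_lowering[OF assms(2,3) q]] by blast
  show ?thesis
    using zero_sectional_of_descent[OF assms(1) ran \<Psi>] path_homotopic_to_unique_section[OF assms(1) ran \<Psi>]
    by blast
qed

end
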